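(* Let $X$ be any normed space of countably infinite dimension. Then there exists an equivalent norm $|||\cdot|||$ on $X$ such that $(X,|||\cdot|||)$ is (V)-polyhedral and its unit ball has no algebraic true faces. Further, the unit ball of $(X,|||\cdot|||)$ is the convex hull (without taking closure) of its extreme points.
   Context: All normed spaces are real. The dimension of a normed space is the algebraic dimension, i.e. the cardinality of an algebraic (Hamel) basis. For a normed space $X$, $B_X$ and $S_X$ denote its closed unit ball and unit sphere, and $X^*$ its topological dual. $\operatorname{ext} C$ is the set of extreme points of a convex set $C$. For $x\in S_X$ let $\mathcal D(x)=\{f\in S_{X^*}: f(x)=1\}$. (V)-polyhedral: $\sup\{f(x): f\in \operatorname{ext}B_{X^*}\setminus\mathcal D(x)\}<1$ for every $x\in S_X$. Algebraic true face of $B_X$: a set $F=B_X\cap H$, where $H=f^{-1}(1)$ with $f\in S_{X^*}$ is a hyperplane meeting $B_X$, whose algebraic interior relative to $H$ is non-empty; here $p\in F$ is in the algebraic interior of $F$ relative to $H$ if for every $q\in H$ there is $\delta>0$ with $p+t(q-p)\in F$ for all $|t|\le\delta$. *)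

theory Defs
  imports "HOL-Analysis.Analysis"
begin

definition is_norm :: "('a::real_vector \<Rightarrow> real) \<Rightarrow> bool" where
  "is_norm N \<longleftrightarrow>
     (\<forall>x. 0 \<le> N x) \<and> (\<forall>x. N x = 0 \<longleftrightarrow> x = 0) \<and>
     (\<forall>x y. N (x + y) \<le> N x + N y) \<and> (\<forall>a x. N (a *\<^sub>R x) = \<bar>a\<bar> * N x)"

definition equivalent_norm :: "('a::real_normed_vector \<Rightarrow> real) \<Rightarrow> bool" where
  "equivalent_norm N \<longleftrightarrow>
     is_norm N \<and> (\<exists>c>0. \<exists>C>0. \<forall>x. c * norm x \<le> N x \<and> N x \<le> C * norm x)"

definition unit_ball :: "('a::real_vector \<Rightarrow> real) \<Rightarrow> 'a set" where
  "unit_ball N = {x. N x \<le> 1}"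

definition unit_sphere :: "('a::real_vector \<Rightarrow> real) \<Rightarrow> 'a set" where
  "unit_sphere N = {x. N x = 1}"

definition ext :: "'a::real_vector set \<Rightarrow> 'a set" where
  "ext C = {x. x extreme_point_of C}"

text \<open>The dual of the space renormed by N is represented by the type of functionals that are
  bounded for the original norm. This is the correct topological dual, and the supremum below
  is finite, whenever N is equivalent to the original norm; the definitions that follow are meant
  for such N only.\<close>

definition dual_norm :: "('a::real_normed_vector \<Rightarrow> real) \<Rightarrow> ('a \<Rightarrow>\<^sub>L real) \<Rightarrow> real" where
  "dual_norm N f = (SUP x\<in>unit_ball N. \<bar>blinfun_apply f x\<bar>)"

definition norming_functionals ::
    "('a::real_normed_vector \<Rightarrow> real) \<Rightarrow> 'a \<Rightarrow> ('a \<Rightarrow>\<^sub>L real) set" where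
  "norming_functionals N x = {f \<in> unit_sphere (dual_norm N). blinfun_apply f x = 1}"

text \<open>The supremum is taken in the extended reals, so that it needs no side condition
  (non-emptiness, boundedness) to be meaningful.\<close>

definition V_polyhedral :: "('a::real_normed_vector \<Rightarrow> real) \<Rightarrow> bool" where
  "V_polyhedral N \<longleftrightarrow>
     (\<forall>x\<in>unit_sphere N.
        (SUP f\<in>ext (unit_ball (dual_norm N)) - norming_functionals N x.
           ereal (blinfun_apply f x)) < 1)"

definition algebraic_interior_rel :: "'a::real_vector set \<Rightarrow> 'a set \<Rightarrow> 'a set" where
  "algebraic_interior_rel F H =
     {p \<in> F. \<forall>q\<in>H. \<exists>\<delta>>0. \<forall>t. \<bar>t\<bar> \<le> \<delta> \<longrightarrow> p + t *\<^sub>R (q - p) \<in> F}"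

definition algebraic_true_face :: "('a::real_normed_vector \<Rightarrow> real) \<Rightarrow> 'a set \<Rightarrow> bool" where
  "algebraic_true_face N F \<longleftrightarrow>
     (\<exists>f\<in>unit_sphere (dual_norm N). \<exists>H. H = {x. blinfun_apply f x = 1} \<and>
        unit_ball N \<inter> H \<noteq> {} \<and> F = unit_ball N \<inter> H \<and> algebraic_interior_rel F H \<noteq> {})"

end

theory Submission
  imports Defs
begin

text \<open>
  On the finitely supported sequences the \<open>\<ell>\<^sub>1\<close>-norm has all the required properties: at a point \<open>x\<close> it is
  a finite sum of absolute values, so its extreme functionals take finitely many values at \<open>x\<close>;
  it has a kink at \<open>x\<close> in every coordinate direction outside the support of \<open>x\<close>, so no point is
  smooth and hence none lies in the algebraic interior of a true face; and for the same reason extreme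
  points of finite-dimensional sections of the ball are extreme in the ball. The proof adds small
  \<open>\<ell>\<^sub>1\<close>-like terms to a polyhedral renorming of the given space so that these three effects persist.

  Let \<open>X n\<close> be the span of the first \<open>n\<close> basis vectors, and let \<open>\<xi> n\<close> be a continuous functional that
  vanishes on \<open>X n\<close> but not at the next basis vector. Choose a finite set \<open>F n\<close> of functionals in
  the dual unit ball that almost norms \<open>X n\<close>. The new norm \<open>N\<close> is the supremum of the layers
    \<open>layer n x = a\<^sub>n * max {\<bar>\<phi> x\<bar> | \<phi> \<in> F n} + b\<^sub>n * (\<Sum>m\<ge>n. (1/2)\<^bsup>m+1\<^esup> * \<bar>\<xi> m x\<bar>)\<close>
  with \<open>a\<^sub>n\<close> slightly larger than 1, \<open>b\<^sub>n > 0\<close> small and both decreasing in such a way that, on \<open>X n\<close>, all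
  layers after layer \<open>n\<close> are strictly smaller than layer \<open>n\<close> (\<open>far_less_N\<close>). So near a point of
  \<open>X n\<close> only finitely many layers matter, and each of them contains all the kinks \<open>\<bar>\<xi> m x\<bar>\<close> with
  \<open>m \<ge> n\<close>.

  The kinks give \<open>segment_in_ball_stays_in_X\<close>: a segment of the ball centred at a point of the sphere in
  \<open>X n\<close> stays in \<open>X n\<close>. This excludes algebraic true faces, whose interior points are centres of segments
  in all directions of a hyperplane. It also makes extreme points of the section of the ball by \<open>X n\<close>
  extreme in the ball, so that Minkowski's theorem, applied in \<open>X n\<close>, represents every point of the ball
  as a convex combination of extreme points.

  For (V)-polyhedrality, an extreme functional of a maximum of two seminorms is one of either of them
  (\<open>extreme_functional_max\<close>), and an extreme functional of a sum is a sum of extreme functionals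
  (\<open>extreme_functional_sum\<close>); both follow from the Hahn--Banach theorem on a product space. Hence, at a
  point \<open>x\<close> of the sphere in \<open>X n\<close>, an extreme functional of \<open>N\<close> either comes from the first layers, which
  allow only finitely many values at \<open>x\<close>, or is bounded there by the remaining layers, which stay below 1.
\<close>

section \<open>The Hahn--Banach theorem by minimal sublinear functionals\<close>

definition sublinear :: "('a::real_vector \<Rightarrow> real) \<Rightarrow> bool" where
  "sublinear p \<longleftrightarrow> (\<forall>x y. p (x + y) \<le> p x + p y) \<and> (\<forall>t\<ge>0. \<forall>x. p (t *\<^sub>R x) \<le> t * p x)"

lemma sublinearI:
  assumes "\<And>x y. p (x + y) \<le> p x + p y" and "\<And>t x. 0 \<le> t \<Longrightarrow> p (t *\<^sub>R x) \<le> t * p x"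
  shows "sublinear p"
  using assms by (simp add: sublinear_def)

lemma
  assumes "sublinear p"
  shows sublinear_add: "p (x + y) \<le> p x + p y"
    and sublinear_scale_le: "0 \<le> t \<Longrightarrow> p (t *\<^sub>R x) \<le> t * p x"
    and sublinear_zero: "p 0 = 0"
    and sublinear_neg_le: "- p (- x) \<le> p x"
proof -
  show add: "p (x + y) \<le> p x + p y" for x y using assms by (simp add: sublinear_def)
  show sc: "0 \<le> t \<Longrightarrow> p (t *\<^sub>R x) \<le> t * p x" for t x using assms by (simp add: sublinear_def)
  show z: "p 0 = 0" using add[of 0 0] sc[of 0 0] by simp
  show "- p (- x) \<le> p x" using add[of x "- x"] z by simp
qed

lemma sublinear_scale:
  assumes "sublinear p" and "0 \<le> t"
  shows "p (t *\<^sub>R x) = t * p x"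
proof (cases "t = 0")
  case False
  then have "p x \<le> inverse t * p (t *\<^sub>R x)"
    using sublinear_scale_le[OF assms(1), of "inverse t" "t *\<^sub>R x"] assms(2) by simp
  then have "t * p x \<le> p (t *\<^sub>R x)" using False assms(2) by (simp add: field_simps)
  then show ?thesis using sublinear_scale_le[OF assms] by (simp add: order_antisym)
qed (simp add: sublinear_zero[OF assms(1)])

lemma linear_minus_le:
  assumes "linear f" and "\<And>x. f x \<le> (q x :: real)"
  shows "- q (- x) \<le> f x"
  using assms(2)[of "- x"] linear_neg[OF assms(1), of x] by simp

text \<open>The lower bound \<open>- p (- x)\<close> for sublinear functionals below \<open>p\<close> makes the infimum finite;
  it is subadditive because two members of a chain can be replaced by the smaller one.\<close>

lemma sublinear_chain_Inf:
  assumes C: "C \<noteq> {}" "\<And>q. q \<in> C \<Longrightarrow> sublinear q \<and> (\<forall>x. q x \<le> p x)"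
    and chain: "\<And>q r. q \<in> C \<Longrightarrow> r \<in> C \<Longrightarrow> (\<forall>x. q x \<le> r x) \<or> (\<forall>x. r x \<le> q x)"
  shows "sublinear (\<lambda>x. INF q\<in>C. q x)" and "\<And>q x. q \<in> C \<Longrightarrow> (INF q\<in>C. q x) \<le> q x"
proof -
  have bdd: "bdd_below ((\<lambda>q. q x) ` C)" for x
  proof (rule bdd_belowI2[where m = "- p (- x)"])
    fix q assume "q \<in> C"
    then show "- p (- x) \<le> q x"
      using C(2)[of q] sublinear_neg_le[of q x] by (meson neg_le_iff_le order_trans)
  qed
  show le: "(INF q\<in>C. q x) \<le> q x" if "q \<in> C" for q x
    by (rule cINF_lower[OF bdd that])
  show "sublinear (\<lambda>x. INF q\<in>C. q x)"
  proof (rule sublinearI)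
    fix x y
    have "(INF q\<in>C. q (x + y)) \<le> q x + r y" if qr: "q \<in> C" "r \<in> C" for q r
    proof -
      obtain s where "s \<in> C" "s x \<le> q x" "s y \<le> r y"
        using chain[OF qr] qr by blast
      then show ?thesis
        using le[of s "x + y"] sublinear_add[of s x y] C(2) by fastforce
    qed
    then have *: "(INF q\<in>C. q (x + y)) - q x \<le> r y" if "q \<in> C" "r \<in> C" for q r
      using that by (simp add: diff_le_eq add.commute)
    have "(INF q\<in>C. q (x + y)) - q x \<le> (INF r\<in>C. r y)" if "q \<in> C" for q
      by (rule cINF_greatest[OF C(1) *[OF that]])
    then have "(INF q\<in>C. q (x + y)) - (INF r\<in>C. r y) \<le> q x" if "q \<in> C" for q
      using that by (simp add: diff_le_eq add.commute)
    then have "(INF q\<in>C. q (x + y)) - (INF r\<in>C. r y) \<le> (INF q\<in>C. q x)"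
      by (rule cINF_greatest[OF C(1)])
    then show "(INF q\<in>C. q (x + y)) \<le> (INF q\<in>C. q x) + (INF q\<in>C. q y)" by simp
  next
    fix t :: real and x :: 'a assume t: "0 \<le> t"
    show "(INF q\<in>C. q (t *\<^sub>R x)) \<le> t * (INF q\<in>C. q x)"
    proof (cases "t = 0")
      case True
      obtain q where "q \<in> C" using C(1) by blast
      then show ?thesis using True le[of q 0] C(2) sublinear_zero[of q] by simp
    next
      case False
      have "(INF q\<in>C. q (t *\<^sub>R x)) / t \<le> (INF q\<in>C. q x)"
      proof (rule cINF_greatest[OF C(1)])
        fix q assume q: "q \<in> C"
        have "(INF q\<in>C. q (t *\<^sub>R x)) \<le> t * q x"
          using le[OF q, of "t *\<^sub>R x"] sublinear_scale_le[of q t x] C(2)[OF q] t by linarith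
        then show "(INF q\<in>C. q (t *\<^sub>R x)) / t \<le> q x" using t False by (simp add: field_simps)
      qed
      then show ?thesis using t False by (simp add: field_simps)
    qed
  qed
qed

text \<open>For fixed \<open>y\<close> the infimum of \<open>q (x + t *\<^sub>R y) - t * q y\<close> over \<open>t \<ge> 0\<close> is sublinear in \<open>x\<close> and
  below \<open>q\<close>. If \<open>q\<close> is minimal, it equals this infimum, and \<open>t = 1\<close> gives the missing half of
  additivity.\<close>

lemma minimal_sublinear_linear:
  assumes q: "sublinear q"
    and min: "\<And>r. sublinear r \<Longrightarrow> (\<And>x. r x \<le> q x) \<Longrightarrow> r = q"
  shows "linear q"
proof -
  note qa = sublinear_add[OF q] and qs = sublinear_scale[OF q]
  have additive: "q (x + y) = q x + q y" for x y
  proof -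
    define r where "r x = (INF t\<in>{0..}. q (x + t *\<^sub>R y) - t * q y)" for x
    have bdd: "bdd_below ((\<lambda>t. q (x + t *\<^sub>R y) - t * q y) ` {0..})" for x
    proof (rule bdd_belowI2[where m = "- q (- x)"])
      fix t :: real assume "t \<in> {0..}"
      then show "- q (- x) \<le> q (x + t *\<^sub>R y) - t * q y"
        using qa[of "x + t *\<^sub>R y" "- x"] qs[of t y] by simp
    qed
    have le: "r x \<le> q (x + t *\<^sub>R y) - t * q y" if "0 \<le> t" for x t
      unfolding r_def by (rule cINF_lower[OF bdd]) (use that in simp)
    have "sublinear r"
    proof (rule sublinearI)
      fix x1 x2
      have *: "r (x1 + x2) \<le> (q (x1 + t1 *\<^sub>R y) - t1 * q y) + (q (x2 + t2 *\<^sub>R y) - t2 * q y)"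
        if "0 \<le> t1" "0 \<le> t2" for t1 t2
        using le[of "t1 + t2" "x1 + x2"] qa[of "x1 + t1 *\<^sub>R y" "x2 + t2 *\<^sub>R y"] that
        by (simp add: algebra_simps)
      have "r (x1 + x2) - (q (x1 + t1 *\<^sub>R y) - t1 * q y) \<le> r x2" if "0 \<le> t1" for t1
        unfolding r_def[of x2]
      proof (rule cINF_greatest)
        fix t2 :: real assume "t2 \<in> {0..}"
        then show "r (x1 + x2) - (q (x1 + t1 *\<^sub>R y) - t1 * q y) \<le> q (x2 + t2 *\<^sub>R y) - t2 * q y"
          using *[OF that, of t2] by simp
      qed simp
      note ** = this
      have "r (x1 + x2) - r x2 \<le> r x1"
        unfolding r_def[of x1]
      proof (rule cINF_greatest)
        fix t1 :: real assume "t1 \<in> {0..}"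
        then show "r (x1 + x2) - r x2 \<le> q (x1 + t1 *\<^sub>R y) - t1 * q y"
          using **[of t1] by simp
      qed simp
      then show "r (x1 + x2) \<le> r x1 + r x2" by simp
    next
      fix s :: real and x :: 'a assume s: "0 \<le> s"
      show "r (s *\<^sub>R x) \<le> s * r x"
      proof (cases "s = 0")
        case True
        then show ?thesis using le[of 0 0] sublinear_zero[OF q] by simp
      next
        case False
        have "r (s *\<^sub>R x) / s \<le> r x"
          unfolding r_def[of x]
        proof (rule cINF_greatest)
          fix t :: real assume t: "t \<in> {0..}"
          have "r (s *\<^sub>R x) \<le> s * (q (x + t *\<^sub>R y) - t * q y)"
            using le[of "s * t" "s *\<^sub>R x"] qs[OF s, of "x + t *\<^sub>R y"] s t
            by (simp add: algebra_simps)
          then show "r (s *\<^sub>R x) / s \<le> q (x + t *\<^sub>R y) - t * q y"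
            using s False by (simp add: field_simps)
        qed simp
        then show ?thesis using s False by (simp add: field_simps)
      qed
    qed
    moreover have "r x \<le> q x" for x using le[of 0 x] by simp
    ultimately have "r = q" by (rule min)
    then show ?thesis using le[of 1 x] qa[of x y] by simp
  qed
  have neg: "q (- x) = - q x" for x
    using additive[of x "- x"] sublinear_zero[OF q] by simp
  show ?thesis
  proof (rule linearI)
    fix c :: real and x :: 'a
    show "q (c *\<^sub>R x) = c *\<^sub>R q x"
      using qs[of c x] qs[of "- c" x] neg[of "c *\<^sub>R x"] by (cases "0 \<le> c") auto
  qed (rule additive)
qed

lemma sublinear_dominates_linear:
  assumes p: "sublinear p"
  obtains f where "linear f" and "\<And>x. f x \<le> p x"
proof -
  define A where "A = {q. sublinear q \<and> (\<forall>x. q x \<le> p x)}"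
  define P where "P = (\<lambda>q r :: 'a \<Rightarrow> real. \<forall>x. r x \<le> q x)"
  have "\<exists>m\<in>A. \<forall>a\<in>A. P m a \<longrightarrow> a = m"
  proof (rule predicate_Zorn)
    show "partial_order_on A (relation_of P A)"
      by (rule partial_order_on_relation_ofI) (auto simp: P_def intro!: order_antisym ext intro: order_trans)
    fix C assume C: "C \<in> Chains (relation_of P A)"
    then have sub: "C \<subseteq> A" and ch: "\<And>q r. q \<in> C \<Longrightarrow> r \<in> C \<Longrightarrow> P q r \<or> P r q"
      by (auto simp: Chains_def relation_of_def)
    show "\<exists>u\<in>A. \<forall>a\<in>C. P a u"
    proof (cases "C = {}")
      case True
      then show ?thesis using p by (auto simp: A_def)
    next
      case False
      have C2: "\<And>q. q \<in> C \<Longrightarrow> sublinear q \<and> (\<forall>x. q x \<le> p x)" using sub by (auto simp: A_def)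
      have ch': "\<And>q r. q \<in> C \<Longrightarrow> r \<in> C \<Longrightarrow> (\<forall>x. q x \<le> r x) \<or> (\<forall>x. r x \<le> q x)"
        using ch by (fastforce simp: P_def)
      note inf = sublinear_chain_Inf[of C p, OF False C2 ch']
      define u where "u = (\<lambda>x. INF q\<in>C. q x)"
      have u: "sublinear u" "\<And>q x. q \<in> C \<Longrightarrow> u x \<le> q x"
        unfolding u_def using inf by blast+
      obtain q where "q \<in> C" using False by blast
      then have "u x \<le> p x" for x using u(2) C2 order_trans by blast
      then have "u \<in> A" using u by (simp add: A_def)
      then show ?thesis using u(2) by (auto simp: P_def)
    qed
  qed
  then obtain m where m: "m \<in> A" "\<And>a. a \<in> A \<Longrightarrow> P m a \<Longrightarrow> a = m" by blast
  have "linear m"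
  proof (rule minimal_sublinear_linear)
    show "sublinear m" using m(1) by (simp add: A_def)
    fix r :: "'a \<Rightarrow> real" assume r: "sublinear r" "\<And>x. r x \<le> m x"
    then have "r \<in> A" using m(1) order_trans by (fastforce simp: A_def)
    then show "r = m" using r(2) by (intro m(2)) (auto simp: P_def)
  qed
  then show ?thesis using that m(1) by (auto simp: A_def)
qed

text \<open>The infimum of \<open>p (x - s) + f s\<close> over \<open>s \<in> S\<close> is sublinear, lies below \<open>p\<close> everywhere and
  below \<open>f\<close> on \<open>S\<close>; a linear functional below \<open>f\<close> on a subspace agrees with it there.\<close>

lemma Hahn_Banach_sublinear:
  assumes p: "sublinear p" and S: "subspace S" and f: "linear f"
    and fp: "\<And>s. s \<in> S \<Longrightarrow> f s \<le> p s"
  obtains g where "linear g" and "\<And>s. s \<in> S \<Longrightarrow> g s = f s" and "\<And>x. g x \<le> p x"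
proof -
  define r where "r x = (INF s\<in>S. p (x - s) + f s)" for x
  have ne: "S \<noteq> {}" using subspace_0[OF S] by blast
  note pa = sublinear_add[OF p]
  have bdd: "bdd_below ((\<lambda>s. p (x - s) + f s) ` S)" for x
  proof (rule bdd_belowI2[where m = "- p (- x)"])
    fix s assume "s \<in> S"
    then have "- f s \<le> p (- s)"
      using fp[of "- s"] linear_neg[OF f, of s] subspace_neg[OF S] by simp
    also have "\<dots> \<le> p (x - s) + p (- x)" using pa[of "x - s" "- x"] by simp
    finally show "- p (- x) \<le> p (x - s) + f s" by simp
  qed
  have le: "r x \<le> p (x - s) + f s" if "s \<in> S" for x s
    unfolding r_def using that by (rule cINF_lower[OF bdd])
  have "sublinear r"
  proof (rule sublinearI)
    fix x y
    have *: "r (x + y) \<le> (p (x - s) + f s) + (p (y - t) + f t)" if "s \<in> S" "t \<in> S" for s t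
      using le[of "s + t" "x + y"] that pa[of "x - s" "y - t"] subspace_add[OF S]
      by (simp add: linear_add[OF f] algebra_simps)
    have **: "r (x + y) - (p (x - s) + f s) \<le> r y" if "s \<in> S" for s
      unfolding r_def[of y]
    proof (rule cINF_greatest[OF ne])
      fix t assume "t \<in> S"
      then show "r (x + y) - (p (x - s) + f s) \<le> p (y - t) + f t" using *[OF that, of t] by simp
    qed
    have "r (x + y) - r y \<le> r x"
      unfolding r_def[of x]
    proof (rule cINF_greatest[OF ne])
      fix s assume "s \<in> S"
      then show "r (x + y) - r y \<le> p (x - s) + f s" using **[of s] by simp
    qed
    then show "r (x + y) \<le> r x + r y" by simp
  next
    fix t :: real and x :: 'a assume t: "0 \<le> t"
    show "r (t *\<^sub>R x) \<le> t * r x"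
    proof (cases "t = 0")
      case True
      then show ?thesis
        using le[of 0 0] sublinear_zero[OF p] linear_0[OF f] subspace_0[OF S] by simp
    next
      case False
      have "r (t *\<^sub>R x) / t \<le> r x"
        unfolding r_def[of x]
      proof (rule cINF_greatest[OF ne])
        fix s assume "s \<in> S"
        then have "r (t *\<^sub>R x) \<le> t * (p (x - s) + f s)"
          using le[of "t *\<^sub>R s" "t *\<^sub>R x"] sublinear_scale[OF p t, of "x - s"] subspace_scale[OF S]
          by (simp add: linear_scale[OF f] algebra_simps)
        then show "r (t *\<^sub>R x) / t \<le> p (x - s) + f s" using t False by (simp add: field_simps)
      qed
      then show ?thesis using t False by (simp add: field_simps)
    qed
  qed
  then obtain g where g: "linear g" "\<And>x. g x \<le> r x" by (rule sublinear_dominates_linear) blast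
  have le_f: "g s \<le> f s" if "s \<in> S" for s
    using g(2)[of s] le[OF that, of s] sublinear_zero[OF p] by simp
  have "g s = f s" if "s \<in> S" for s
    using le_f[OF that] le_f[of "- s"] subspace_neg[OF S that] linear_neg[OF g(1)] linear_neg[OF f]
    by (simp add: order_antisym)
  moreover have "g x \<le> p x" for x
    using g(2)[of x] le[of 0 x] subspace_0[OF S] linear_0[OF f] by simp
  ultimately show ?thesis using that g(1) by blast
qed

section \<open>Extreme functionals below a seminorm\<close>

definition seminorm :: "('a::real_vector \<Rightarrow> real) \<Rightarrow> bool" where
  "seminorm q \<longleftrightarrow> (\<forall>x y. q (x + y) \<le> q x + q y) \<and> (\<forall>c x. q (c *\<^sub>R x) = \<bar>c\<bar> * q x)"

lemma seminormI:
  assumes "\<And>x y. q (x + y) \<le> q x + q y" and "\<And>c x. q (c *\<^sub>R x) = \<bar>c\<bar> * q x"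
  shows "seminorm q"
  using assms by (simp add: seminorm_def)

lemma
  assumes "seminorm q"
  shows seminorm_add: "q (x + y) \<le> q x + q y"
    and seminorm_scale: "q (c *\<^sub>R x) = \<bar>c\<bar> * q x"
    and seminorm_zero: "q 0 = 0"
    and seminorm_minus: "q (- x) = q x"
    and seminorm_nonneg: "0 \<le> q x"
proof -
  show add: "q (x + y) \<le> q x + q y" for x y using assms by (simp add: seminorm_def)
  show sc: "q (c *\<^sub>R x) = \<bar>c\<bar> * q x" for c x using assms by (simp add: seminorm_def)
  show z: "q 0 = 0" using sc[of 0 0] by simp
  show m: "q (- x) = q x" using sc[of "-1" x] by simp
  show "0 \<le> q x" using add[of x "- x"] z m by simp
qed

lemma seminorm_imp_sublinear: "seminorm q \<Longrightarrow> sublinear q"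
  by (rule sublinearI) (simp_all add: seminorm_add seminorm_scale)

lemma seminorm_norm: "seminorm (norm :: 'a::real_normed_vector \<Rightarrow> real)"
  by (rule seminormI) (simp_all add: norm_triangle_ineq)

lemma seminorm_abs_linear:
  assumes "linear (f :: 'a::real_vector \<Rightarrow> real)" and "0 \<le> c"
  shows "seminorm (\<lambda>x. c * \<bar>f x\<bar>)"
proof (rule seminormI)
  fix x y :: 'a and d :: real
  have "\<bar>f (x + y)\<bar> \<le> \<bar>f x\<bar> + \<bar>f y\<bar>" by (simp add: linear_add[OF assms(1)])
  then show "c * \<bar>f (x + y)\<bar> \<le> c * \<bar>f x\<bar> + c * \<bar>f y\<bar>"
    using mult_left_mono[OF _ assms(2)] by (fastforce simp flip: distrib_left)
  show "c * \<bar>f (d *\<^sub>R x)\<bar> = \<bar>d\<bar> * (c * \<bar>f x\<bar>)"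
    by (simp add: linear_scale[OF assms(1)] abs_mult)
qed

lemma seminorm_sum_of_two:
  assumes "seminorm p" and "seminorm q"
  shows "seminorm (\<lambda>x. p x + q x)"
proof (rule seminormI)
  fix x y
  show "p (x + y) + q (x + y) \<le> p x + q x + (p y + q y)"
    using seminorm_add[OF assms(1), of x y] seminorm_add[OF assms(2), of x y] by linarith
qed (simp add: assms[THEN seminorm_scale] distrib_left)

lemma seminorm_SUP:
  assumes I: "I \<noteq> {}" and q: "\<And>i. i \<in> I \<Longrightarrow> seminorm (q i)"
    and bdd: "\<And>x. bdd_above ((\<lambda>i. q i x) ` I)"
  shows "seminorm (\<lambda>x. SUP i\<in>I. q i x)"
proof (rule seminormI)
  have le: "q i x \<le> (SUP i\<in>I. q i x)" if "i \<in> I" for i x by (rule cSUP_upper[OF that bdd])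
  show "(SUP i\<in>I. q i (x + y)) \<le> (SUP i\<in>I. q i x) + (SUP i\<in>I. q i y)" for x y
  proof (rule cSUP_least[OF I])
    fix i assume "i \<in> I"
    then show "q i (x + y) \<le> (SUP i\<in>I. q i x) + (SUP i\<in>I. q i y)"
      using le[of i x] le[of i y] seminorm_add[OF q, of i x y] by linarith
  qed
  show "(SUP i\<in>I. q i (c *\<^sub>R x)) = \<bar>c\<bar> * (SUP i\<in>I. q i x)" for c x
  proof (cases "c = 0")
    case True
    then show ?thesis using I by (simp add: seminorm_zero[OF q])
  next
    case False
    have "(SUP i\<in>I. q i (c *\<^sub>R x)) \<le> \<bar>c\<bar> * (SUP i\<in>I. q i x)" for c x
    proof (rule cSUP_least[OF I])
      fix i assume "i \<in> I"
      then show "q i (c *\<^sub>R x) \<le> \<bar>c\<bar> * (SUP i\<in>I. q i x)"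
        by (simp add: seminorm_scale[OF q] mult_left_mono le)
    qed
    note this[of c x] this[of "inverse c" "c *\<^sub>R x"]
    then show ?thesis using False by (simp add: field_simps)
  qed
qed

lemma seminorm_max:
  assumes "seminorm p" and "seminorm q"
  shows "seminorm (\<lambda>x. max (p x) (q x))"
proof (rule seminormI)
  fix x y
  show "max (p (x + y)) (q (x + y)) \<le> max (p x) (q x) + max (p y) (q y)"
    using seminorm_add[OF assms(1), of x y] seminorm_add[OF assms(2), of x y] by linarith
qed (simp add: assms[THEN seminorm_scale] max_mult_distrib_left)

text \<open>The kernel of \<open>\<xi>\<close> lies in the kernel of \<open>f\<close>, so \<open>f\<close> is a multiple of \<open>\<xi>\<close>.\<close>

lemma linear_dominated_by_abs:
  fixes f \<xi> :: "'a::real_vector \<Rightarrow> real"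
  assumes f: "linear f" and \<xi>: "linear \<xi>" and c: "0 \<le> c" and le: "\<And>x. f x \<le> c * \<bar>\<xi> x\<bar>"
  obtains \<theta> where "\<bar>\<theta>\<bar> \<le> c" and "\<And>x. f x = \<theta> * \<xi> x"
proof (cases "\<exists>u. \<xi> u \<noteq> 0")
  case False
  then have "f x = 0" for x
    using le[of x] le[of "- x"] linear_neg[OF f, of x] linear_neg[OF \<xi>, of x] by simp
  then show ?thesis using False c by (intro that[of 0]) auto
next
  case True
  then obtain u where u: "\<xi> u \<noteq> 0" by blast
  have ker: "f y = 0" if "\<xi> y = 0" for y
    using le[of y] le[of "- y"] linear_neg[OF f, of y] linear_neg[OF \<xi>, of y] that by simp
  show ?thesis
  proof (rule that[of "f u / \<xi> u"])
    show "f x = f u / \<xi> u * \<xi> x" for x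
    proof -
      have "\<xi> (x - (\<xi> x / \<xi> u) *\<^sub>R u) = 0"
        using u by (simp add: linear_diff[OF \<xi>] linear_scale[OF \<xi>])
      then have "f x = (\<xi> x / \<xi> u) * f u"
        using ker by (fastforce simp: linear_diff[OF f] linear_scale[OF f])
      then show ?thesis by simp
    qed
    have "\<bar>f u\<bar> \<le> c * \<bar>\<xi> u\<bar>"
      using le[of u] le[of "- u"] linear_neg[OF f, of u] linear_neg[OF \<xi>, of u] by simp
    then show "\<bar>f u / \<xi> u\<bar> \<le> c" using u by (simp add: field_simps)
  qed
qed

text \<open>For a norm \<open>q\<close> these are the extreme points of the dual unit ball. The symmetric form makes
  sense for every seminorm and does not depend on a vector space of functionals.\<close>

definition extreme_functional :: "('a::real_vector \<Rightarrow> real) \<Rightarrow> ('a \<Rightarrow> real) \<Rightarrow> bool" where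
  "extreme_functional q f \<longleftrightarrow> linear f \<and> (\<forall>x. f x \<le> q x) \<and>
     (\<forall>g. linear g \<longrightarrow> (\<forall>x. f x + g x \<le> q x \<and> f x - g x \<le> q x) \<longrightarrow> (\<forall>x. g x = 0))"

lemma
  assumes "extreme_functional q f"
  shows extreme_functional_linear: "linear f"
    and extreme_functional_le: "f x \<le> q x"
    and extreme_functionalD: "linear g \<Longrightarrow> (\<And>x. f x + g x \<le> q x) \<Longrightarrow> (\<And>x. f x - g x \<le> q x) \<Longrightarrow> g x = 0"
  using assms by (auto simp: extreme_functional_def)

lemma extreme_functional_smaller:
  assumes "extreme_functional q f" and "\<And>x. p x \<le> q x" and "\<And>x. f x \<le> p x"
  shows "extreme_functional p f"
  unfolding extreme_functional_def
  using extreme_functional_linear[OF assms(1)] assms(3)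
    extreme_functionalD[OF assms(1)] assms(2) by (meson order_trans)

text \<open>Both decompositions of a dominated functional below come from the Hahn--Banach theorem on the
  diagonal of the product space.\<close>

lemma linear_le_coupled:
  fixes f :: "'a::real_vector \<Rightarrow> real"
  assumes f: "linear f" and Q: "sublinear Q" and le: "\<And>x. f x \<le> Q (x, x)"
  obtains g h where "linear g" "linear h" "\<And>x. f x = g x + h x" "\<And>x y. g x + h y \<le> Q (x, y)"
proof -
  let ?D = "range (\<lambda>x::'a. (x, x))"
  have D: "subspace ?D"
    by (intro linear_subspace_image[OF _ subspace_UNIV]) (auto intro!: linearI)
  have ext: "linear (\<lambda>z::'a \<times> 'a. f (fst z))"
    by (rule linearI) (simp_all add: linear_add[OF f] linear_scale[OF f])
  have le': "f (fst z) \<le> Q z" if "z \<in> ?D" for z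
    using that le by auto
  obtain G :: "'a \<times> 'a \<Rightarrow> real" where G: "linear G"
      and diag: "\<And>z. z \<in> ?D \<Longrightarrow> G z = f (fst z)" and GQ: "\<And>z. G z \<le> Q z"
    by (rule Hahn_Banach_sublinear[OF Q D ext le'], assumption, rule that)
  have Gf: "G (x, x) = f x" for x using diag[of "(x, x)"] by simp
  have split: "G (x, 0) + G (0, y) = G (x, y)" for x y
    by (simp flip: linear_add[OF G])
  show ?thesis
  proof (rule that[of "\<lambda>x. G (x, 0)" "\<lambda>y. G (0, y)"])
    have "linear (\<lambda>x::'a. (x, 0::'a))" "linear (\<lambda>x::'a. (0::'a, x))"
      by (auto intro!: linearI)
    from this[THEN linear_compose, OF G] show "linear (\<lambda>x. G (x, 0))" "linear (\<lambda>x. G (0, x))"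
      by (simp_all add: o_def)
  qed (simp_all add: split Gf GQ)
qed

lemma linear_le_sum_decompose:
  fixes f :: "'a::real_vector \<Rightarrow> real"
  assumes f: "linear f" and p: "seminorm p" and q: "seminorm q" and le: "\<And>x. f x \<le> p x + q x"
  obtains g h where "linear g" "linear h" "\<And>x. f x = g x + h x" "\<And>x. g x \<le> p x" "\<And>x. h x \<le> q x"
proof -
  have "seminorm (\<lambda>z. p (fst z) + q (snd z))"
  proof (rule seminormI)
    fix x y :: "'a \<times> 'a"
    show "p (fst (x + y)) + q (snd (x + y)) \<le> p (fst x) + q (snd x) + (p (fst y) + q (snd y))"
      using seminorm_add[OF p, of "fst x" "fst y"] seminorm_add[OF q, of "snd x" "snd y"] by simp
  qed (simp add: seminorm_scale[OF p] seminorm_scale[OF q] distrib_left)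
  then have "sublinear (\<lambda>z. p (fst z) + q (snd z))" by (rule seminorm_imp_sublinear)
  then obtain g h where gh: "linear g" "linear h" "\<And>x. f x = g x + h x"
      "\<And>x y. g x + h y \<le> p x + q y"
    using le by (rule_tac linear_le_coupled[OF f, where Q = "\<lambda>z. p (fst z) + q (snd z)"]) simp_all
  show ?thesis
    using that[OF gh(1-3)] gh(4)[of _ 0] gh(4)[of 0]
      linear_0[OF gh(1)] linear_0[OF gh(2)] seminorm_zero[OF p] seminorm_zero[OF q] by simp
qed

text \<open>The coupled functional \<open>g x + h y \<le> max (p x) (q y)\<close> says that the dual norms of \<open>g\<close> and \<open>h\<close>
  add up to at most 1, which gives the weights of a convex combination.\<close>

lemma linear_le_max_decompose:
  fixes f :: "'a::real_vector \<Rightarrow> real"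
  assumes f: "linear f" and p: "seminorm p" and q: "seminorm q" and le: "\<And>x. f x \<le> max (p x) (q x)"
  obtains \<mu> g h where "0 \<le> \<mu>" "\<mu> \<le> 1" "linear g" "linear h" "\<And>x. f x = g x + h x"
    "\<And>x. g x \<le> \<mu> * p x" "\<And>x. h x \<le> (1 - \<mu>) * q x"
proof -
  have "seminorm (\<lambda>z. max (p (fst z)) (q (snd z)))"
  proof (rule seminormI)
    fix x y :: "'a \<times> 'a"
    show "max (p (fst (x + y))) (q (snd (x + y))) \<le>
        max (p (fst x)) (q (snd x)) + max (p (fst y)) (q (snd y))"
      using seminorm_add[OF p, of "fst x" "fst y"] seminorm_add[OF q, of "snd x" "snd y"]
      unfolding fst_add snd_add by linarith
  qed (simp add: seminorm_scale[OF p] seminorm_scale[OF q] max_mult_distrib_left)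
  then have "sublinear (\<lambda>z. max (p (fst z)) (q (snd z)))" by (rule seminorm_imp_sublinear)
  then obtain g h where gh: "linear g" "linear h" "\<And>x. f x = g x + h x"
      and coupled: "\<And>x y. g x + h y \<le> max (p x) (q y)"
    using le by (rule_tac linear_le_coupled[OF f, where Q = "\<lambda>z. max (p (fst z)) (q (snd z))"]) simp_all
  note g0 = linear_0[OF gh(1)] and h0 = linear_0[OF gh(2)]
  note p0 = seminorm_zero[OF p] and q0 = seminorm_zero[OF q]
  define U where "U = {u. p u \<le> 1}"
  define \<mu> where "\<mu> = (SUP u\<in>U. g u)"
  have U0: "0 \<in> U" by (simp add: U_def p0)
  have bound: "g u + h v \<le> 1" if "p u \<le> 1" "q v \<le> 1" for u v
    using coupled[of u v] that by simp
  have bdd: "bdd_above (g ` U)"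
    by (rule bdd_aboveI2[where M = 1]) (use bound[of _ 0] h0 q0 in \<open>simp add: U_def\<close>)
  have g_le: "g u \<le> \<mu>" if "p u \<le> 1" for u
    unfolding \<mu>_def by (rule cSUP_upper[OF _ bdd]) (simp add: U_def that)
  have h_le: "h v \<le> 1 - \<mu>" if "q v \<le> 1" for v
  proof -
    have "\<mu> \<le> 1 - h v"
      unfolding \<mu>_def using U0 bound[OF _ that] by (intro cSUP_least) (auto simp: U_def algebra_simps)
    then show ?thesis by simp
  qed
  have \<mu>: "0 \<le> \<mu>" "\<mu> \<le> 1" using g_le[of 0] h_le[of 0] by (simp_all add: g0 h0 p0 q0)
  have scale: "k x \<le> c * r x" if k: "linear k" and r: "seminorm r" and "0 \<le> c"
      and kle: "\<And>u. r u \<le> 1 \<Longrightarrow> k u \<le> c" for k r :: "'a \<Rightarrow> real" and c x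
  proof (cases "r x = 0")
    case True
    have "k x \<le> 0"
    proof (rule ccontr)
      assume pos: "\<not> k x \<le> 0"
      have "k (((c + 1) / k x) *\<^sub>R x) \<le> c"
        by (rule kle) (simp add: seminorm_scale[OF r] True)
      then show False using pos by (simp add: linear_scale[OF k])
    qed
    then show ?thesis using True by simp
  next
    case False
    then have pos: "0 < r x" using seminorm_nonneg[OF r, of x] by simp
    have "k ((1 / r x) *\<^sub>R x) \<le> c"
      by (rule kle) (use pos in \<open>simp add: seminorm_scale[OF r]\<close>)
    then show ?thesis using pos by (simp add: linear_scale[OF k] field_simps)
  qed
  show ?thesis
    using \<mu> g_le h_le by (intro that[OF \<mu> gh] scale p q gh) auto
qed

text \<open>A perturbation admissible for one summand is admissible for the sum, so extremality passes to
  the parts of every decomposition.\<close>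

lemma extreme_functional_sum:
  assumes f: "extreme_functional (\<lambda>x. p x + q x) f" and p: "seminorm p" and q: "seminorm q"
  obtains g h where "extreme_functional p g" "extreme_functional q h" "\<And>x. f x = g x + h x"
proof -
  obtain g h where gh: "linear g" "linear h" "\<And>x. f x = g x + h x" "\<And>x. g x \<le> p x" "\<And>x. h x \<le> q x"
    by (rule linear_le_sum_decompose[OF extreme_functional_linear[OF f] p q extreme_functional_le[OF f]],
        rule that)
  have "extreme_functional p g"
    unfolding extreme_functional_def
  proof (intro conjI allI impI)
    fix k x assume k: "linear k" "\<forall>x. g x + k x \<le> p x \<and> g x - k x \<le> p x"
    have "f x + k x \<le> p x + q x" "f x - k x \<le> p x + q x" for x
      using k(2)[rule_format, of x] gh(5)[of x] by (simp_all add: gh(3))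
    then show "k x = 0" by (rule extreme_functionalD[OF f k(1)])
  qed (use gh in auto)
  moreover have "extreme_functional q h"
    unfolding extreme_functional_def
  proof (intro conjI allI impI)
    fix k x assume k: "linear k" "\<forall>x. h x + k x \<le> q x \<and> h x - k x \<le> q x"
    have "f x + k x \<le> p x + q x" "f x - k x \<le> p x + q x" for x
      using k(2)[rule_format, of x] gh(4)[of x] by (simp_all add: gh(3))
    then show "k x = 0" by (rule extreme_functionalD[OF f k(1)])
  qed (use gh in auto)
  ultimately show ?thesis using that gh(3) by blast
qed

text \<open>A form of Milman's theorem: the dual ball of \<open>max p q\<close> is the convex hull of the dual balls of
  \<open>p\<close> and \<open>q\<close>, so its extreme points lie in one of them.\<close>

lemma extreme_functional_max:
  assumes f: "extreme_functional (\<lambda>x. max (p x) (q x)) f" and p: "seminorm p" and q: "seminorm q"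
  shows "extreme_functional p f \<or> extreme_functional q f"
proof -
  obtain \<mu> g h where \<mu>: "0 \<le> \<mu>" "\<mu> \<le> 1" and gh: "linear g" "linear h" "\<And>x. f x = g x + h x"
    and le: "\<And>x. g x \<le> \<mu> * p x" "\<And>x. h x \<le> (1 - \<mu>) * q x"
    by (rule linear_le_max_decompose[OF extreme_functional_linear[OF f] p q extreme_functional_le[OF f]],
        rule that)
  have "(\<forall>x. f x \<le> p x) \<or> (\<forall>x. f x \<le> q x)"
  proof -
    consider "\<mu> = 0" | "\<mu> = 1" | "\<mu> \<noteq> 0" "\<mu> \<noteq> 1" by blast
    then show ?thesis
    proof cases
      case 1
      have "f x \<le> q x" for x
        using le(1)[of x] le(2)[of x] gh(3)[of x] 1 by simp
      then show ?thesis by blast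
    next
      case 2
      have "f x \<le> p x" for x
        using le(1)[of x] le(2)[of x] gh(3)[of x] 2 by simp
      then show ?thesis by blast
    next
      case 3
      then have pos: "0 < \<mu>" "0 < 1 - \<mu>" using \<mu> by auto
      define k where "k x = (1 - \<mu>) * g x - \<mu> * h x" for x
      have lin: "linear k"
        unfolding k_def
        by (rule linearI) (simp_all add: linear_add gh linear_scale algebra_simps)
      \<comment> \<open>\<open>f + k\<close> and \<open>f - k\<close> are the convex combinations of \<open>g / \<mu>\<close> and \<open>h / (1 - \<mu>)\<close> with first weight
        \<open>\<mu> + \<mu> (1 - \<mu>)\<close> and \<open>\<mu> - \<mu> (1 - \<mu>)\<close>.\<close>
      have gp: "g x \<le> \<mu> * max (p x) (q x)" and hq: "h x \<le> (1 - \<mu>) * max (p x) (q x)" for x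
        using le[of x] mult_left_mono[of "p x" "max (p x) (q x)" \<mu>]
          mult_left_mono[of "q x" "max (p x) (q x)" "1 - \<mu>"] \<mu> by auto
      have "f x + k x \<le> max (p x) (q x)" "f x - k x \<le> max (p x) (q x)" for x
      proof -
        let ?M = "max (p x) (q x)"
        have "f x + k x = (2 - \<mu>) * g x + (1 - \<mu>) * h x"
          by (simp add: k_def gh(3) algebra_simps)
        also have "\<dots> \<le> (2 - \<mu>) * (\<mu> * ?M) + (1 - \<mu>) * ((1 - \<mu>) * ?M)"
          using \<mu> gp hq by (intro add_mono mult_left_mono) auto
        also have "\<dots> = ?M" by (simp add: algebra_simps)
        finally show "f x + k x \<le> ?M" .
        have "f x - k x = \<mu> * g x + (1 + \<mu>) * h x"
          by (simp add: k_def gh(3) algebra_simps)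
        also have "\<dots> \<le> \<mu> * (\<mu> * ?M) + (1 + \<mu>) * ((1 - \<mu>) * ?M)"
          using \<mu> gp hq by (intro add_mono mult_left_mono) auto
        also have "\<dots> = ?M" by (simp add: algebra_simps)
        finally show "f x - k x \<le> ?M" .
      qed
      then have "k x = 0" for x by (rule extreme_functionalD[OF f lin])
      then have "\<mu> * f x = g x" for x by (simp add: k_def gh(3) algebra_simps)
      then have "\<mu> * f x \<le> \<mu> * p x" for x using le(1)[of x] by metis
      then show ?thesis using pos by simp
    qed
  qed
  then show ?thesis using extreme_functional_smaller[OF f] by fastforce
qed

section \<open>Seminorms whose extreme functionals take finitely many values at a point\<close>

text \<open>The property behind (V)-polyhedrality: at such a point the values below 1 stay away from 1. It
  is stable under sums and finite maxima although there may be uncountably many extreme functionals,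
  as for the \<open>\<ell>\<^sub>1\<close>-norm of finitely supported sequences.\<close>

definition finite_values :: "('a::real_vector \<Rightarrow> real) \<Rightarrow> 'a \<Rightarrow> bool" where
  "finite_values q x \<longleftrightarrow> finite {f x | f. extreme_functional q f}"

lemma finite_values_null:
  assumes "seminorm q" and "q x = 0"
  shows "finite_values q x"
proof -
  have "f x = 0" if "extreme_functional q f" for f
    using extreme_functional_le[OF that, of x]
      linear_minus_le[OF extreme_functional_linear[OF that] extreme_functional_le[OF that], of x]
      assms seminorm_minus[OF assms(1), of x] by simp
  then have "{f x | f. extreme_functional q f} \<subseteq> {0}" by auto
  then show ?thesis unfolding finite_values_def by (rule finite_subset) simp
qed

lemma finite_values_abs_linear:
  assumes \<phi>: "linear \<phi>" and c: "0 \<le> c"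
  shows "finite_values (\<lambda>x. c * \<bar>\<phi> x\<bar>) x"
proof -
  have "f x \<in> {c * \<phi> x, - c * \<phi> x, 0}" if f: "extreme_functional (\<lambda>x. c * \<bar>\<phi> x\<bar>) f" for f
  proof -
    obtain \<theta> where \<theta>: "\<bar>\<theta>\<bar> \<le> c" "\<And>x. f x = \<theta> * \<phi> x"
      using linear_dominated_by_abs[OF extreme_functional_linear[OF f] \<phi> c extreme_functional_le[OF f]]
      by metis
    define g where "g x = (c - \<bar>\<theta>\<bar>) * \<phi> x" for x
    have "linear g"
      unfolding g_def by (rule linearI) (simp_all add: linear_add[OF \<phi>] linear_scale[OF \<phi>] algebra_simps)
    moreover have "f x + g x \<le> c * \<bar>\<phi> x\<bar>" "f x - g x \<le> c * \<bar>\<phi> x\<bar>" for x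
    proof -
      have "\<theta> * \<phi> x \<le> \<bar>\<theta>\<bar> * \<bar>\<phi> x\<bar>" by (metis abs_ge_self abs_mult)
      moreover have "\<bar>g x\<bar> = c * \<bar>\<phi> x\<bar> - \<bar>\<theta>\<bar> * \<bar>\<phi> x\<bar>"
        unfolding g_def abs_mult using \<theta>(1) by (simp add: left_diff_distrib)
      ultimately show "f x + g x \<le> c * \<bar>\<phi> x\<bar>" "f x - g x \<le> c * \<bar>\<phi> x\<bar>"
        unfolding \<theta>(2)[of x] by linarith+
    qed
    ultimately have "g x = 0" by (rule extreme_functionalD[OF f])
    then have "\<phi> x = 0 \<or> \<bar>\<theta>\<bar> = c" by (auto simp: g_def)
    then show ?thesis by (auto simp: \<theta>(2) abs_if split: if_splits)
  qed
  then have "{f x | f. extreme_functional (\<lambda>x. c * \<bar>\<phi> x\<bar>) f} \<subseteq> {c * \<phi> x, - c * \<phi> x, 0}" by blast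
  then show ?thesis unfolding finite_values_def by (rule finite_subset) simp
qed

lemma finite_values_sum_of_two:
  assumes "seminorm p" "seminorm q" and fin: "finite_values p x" "finite_values q x"
  shows "finite_values (\<lambda>x. p x + q x) x"
proof -
  let ?V = "\<lambda>r. {f x | f. extreme_functional r f}"
  have "?V (\<lambda>x. p x + q x) \<subseteq> (\<lambda>(s, t). s + t) ` (?V p \<times> ?V q)"
  proof
    fix v assume "v \<in> ?V (\<lambda>x. p x + q x)"
    then obtain f where v: "v = f x" and f: "extreme_functional (\<lambda>x. p x + q x) f" by blast
    obtain g h where "extreme_functional p g" "extreme_functional q h" and fgh: "\<And>x. f x = g x + h x"
      by (rule extreme_functional_sum[OF f assms(1,2)], rule that)
    then have "(g x, h x) \<in> ?V p \<times> ?V q" by blast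
    moreover have "v = (\<lambda>(s, t). s + t) (g x, h x)" by (simp add: v fgh)
    ultimately show "v \<in> (\<lambda>(s, t). s + t) ` (?V p \<times> ?V q)" by (rule rev_image_eqI)
  qed
  moreover have "finite (?V p \<times> ?V q)" using fin by (simp add: finite_values_def)
  ultimately show ?thesis unfolding finite_values_def by (rule finite_subset[OF _ finite_imageI])
qed

lemma finite_values_max:
  assumes "seminorm p" "seminorm q" and fin: "finite_values p x" "finite_values q x"
  shows "finite_values (\<lambda>x. max (p x) (q x)) x"
proof -
  let ?V = "\<lambda>r. {f x | f. extreme_functional r f}"
  have "?V (\<lambda>x. max (p x) (q x)) \<subseteq> ?V p \<union> ?V q"
    using extreme_functional_max[OF _ assms(1,2)] by blast
  moreover have "finite (?V p \<union> ?V q)" using fin by (simp add: finite_values_def)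
  ultimately show ?thesis unfolding finite_values_def by (rule finite_subset)
qed

lemma
  assumes "finite I" "I \<noteq> {}" and q: "\<And>i. i \<in> I \<Longrightarrow> seminorm (q i)"
  shows seminorm_Max: "seminorm (\<lambda>x. Max ((\<lambda>i. q i x) ` I))"
    and finite_values_Max: "(\<And>i. i \<in> I \<Longrightarrow> finite_values (q i) x) \<Longrightarrow>
      finite_values (\<lambda>x. Max ((\<lambda>i. q i x) ` I)) x"
proof -
  have "seminorm (\<lambda>x. Max ((\<lambda>i. q i x) ` I)) \<and>
      ((\<forall>i\<in>I. finite_values (q i) x) \<longrightarrow> finite_values (\<lambda>x. Max ((\<lambda>i. q i x) ` I)) x)"
    using assms
  proof (induction I rule: finite_ne_induct)
    case (insert i J)
    then have "(\<lambda>x. Max ((\<lambda>i. q i x) ` insert i J)) = (\<lambda>x. max (q i x) (Max ((\<lambda>i. q i x) ` J)))"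
      by simp
    then show ?case using insert by (simp add: seminorm_max finite_values_max)
  qed simp
  then show "seminorm (\<lambda>x. Max ((\<lambda>i. q i x) ` I))" "(\<And>i. i \<in> I \<Longrightarrow> finite_values (q i) x) \<Longrightarrow>
      finite_values (\<lambda>x. Max ((\<lambda>i. q i x) ` I)) x" by blast+
qed

section \<open>Finite-dimensional subspaces\<close>

lemma closed_if_compact_cball:
  fixes S :: "'a::real_normed_vector set"
  assumes "\<And>r. compact (cball 0 r \<inter> S)"
  shows "closed S"
proof -
  have "l \<in> S" if x: "\<And>n. x n \<in> S" "x \<longlonglongrightarrow> l" for x :: "nat \<Rightarrow> 'a" and l
  proof -
    have "bounded (range x)" using x(2) by (simp add: convergent_imp_bounded)
    then obtain r where "\<And>n. norm (x n) \<le> r" unfolding bounded_iff by blast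
    then have "\<And>n. x n \<in> cball 0 r \<inter> S" using x(1) by simp
    then have "l \<in> cball 0 r \<inter> S"
      using closed_sequentially[OF compact_imp_closed[OF assms]] x(2) by blast
    then show ?thesis by blast
  qed
  then show ?thesis by (auto simp: closed_sequential_limits)
qed

text \<open>The constant is the distance from \<open>b\<close> to \<open>S\<close>.\<close>

lemma closed_subspace_coefficient_bound:
  fixes S :: "'a::real_normed_vector set"
  assumes S: "subspace S" "closed S" and b: "b \<notin> S"
  obtains d where "0 < d" and "\<And>t z. z \<in> S \<Longrightarrow> \<bar>t\<bar> * d \<le> norm (t *\<^sub>R b + z)"
proof (rule that)
  have ne: "S \<noteq> {}" using subspace_0[OF S(1)] by blast
  show "0 < infdist b S" by (rule infdist_pos_not_in_closed[OF S(2) ne b])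
  show "\<bar>t\<bar> * infdist b S \<le> norm (t *\<^sub>R b + z)" if "z \<in> S" for t z
  proof (cases "t = 0")
    case False
    have "(- 1 / t) *\<^sub>R z \<in> S" using subspace_scale[OF S(1) that] .
    then have "infdist b S \<le> norm (b - (- 1 / t) *\<^sub>R z)"
      using infdist_le dist_norm by metis
    then have "\<bar>t\<bar> * infdist b S \<le> norm (t *\<^sub>R (b - (- 1 / t) *\<^sub>R z))"
      by (simp add: mult_left_mono)
    also have "t *\<^sub>R (b - (- 1 / t) *\<^sub>R z) = t *\<^sub>R b + z"
      using False by (simp add: algebra_simps)
    finally show ?thesis .
  qed simp
qed

text \<open>By induction on \<open>A\<close>: the span of \<open>A\<close> is closed, so the coefficient of a new vector \<open>b\<close> is
  controlled by the norm, and a ball in the larger span is a closed part of a continuous image of an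
  interval times a ball in the span of \<open>A\<close>.\<close>

lemma compact_cball_span:
  fixes A :: "'a::real_normed_vector set"
  assumes "finite A"
  shows "compact (cball 0 r \<inter> span A)"
  using assms
proof (induction A arbitrary: r rule: finite_induct)
  case empty
  have "cball 0 r \<inter> span {} = (if 0 \<le> r then {0::'a} else {})" by auto
  then show ?case by simp
next
  case (insert b A)
  show ?case
  proof (cases "b \<in> span A")
    case True
    then show ?thesis using insert.IH by (simp add: span_redundant)
  next
    case False
    obtain d where d: "0 < d" "\<And>t z. z \<in> span A \<Longrightarrow> \<bar>t\<bar> * d \<le> norm (t *\<^sub>R b + z)"
      using closed_subspace_coefficient_bound[OF subspace_span closed_if_compact_cball[OF insert.IH] False]
      by blast
    define R where "R = r + r / d * norm b"
    define K where "K = (\<lambda>w. fst w *\<^sub>R b + snd w) ` ({- (r / d)..r / d} \<times> (cball 0 R \<inter> span A))"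
    have "compact K"
      unfolding K_def
      by (intro compact_continuous_image compact_Times insert.IH compact_Icc continuous_intros)
    moreover have "cball 0 r \<inter> span (insert b A) = cball 0 r \<inter> K"
    proof (intro equalityI subsetI)
      fix x assume x: "x \<in> cball 0 r \<inter> span (insert b A)"
      then obtain t where t: "x - t *\<^sub>R b \<in> span A" by (auto simp: span_breakdown_eq)
      have r: "norm x \<le> r" using x by simp
      have "\<bar>t\<bar> * d \<le> r" using d(2)[OF t, of t] r by simp
      then have tr: "\<bar>t\<bar> \<le> r / d" using d(1) by (simp add: field_simps)
      have "norm (x - t *\<^sub>R b) \<le> norm x + \<bar>t\<bar> * norm b"
        using norm_triangle_ineq4[of x "t *\<^sub>R b"] by simp
      also have "\<dots> \<le> R" unfolding R_def using r tr by (intro add_mono mult_right_mono) auto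
      finally have "(t, x - t *\<^sub>R b) \<in> {- (r / d)..r / d} \<times> (cball 0 R \<inter> span A)"
        using t tr by auto
      moreover have "x = fst (t, x - t *\<^sub>R b) *\<^sub>R b + snd (t, x - t *\<^sub>R b)" by simp
      ultimately have "x \<in> K" unfolding K_def by (rule rev_image_eqI)
      then show "x \<in> cball 0 r \<inter> K" using x by blast
    next
      fix x assume x: "x \<in> cball 0 r \<inter> K"
      then obtain t z where "x = t *\<^sub>R b + z" "z \<in> span A" unfolding K_def by auto
      then have "x \<in> span (insert b A)"
        using span_mono[of A "insert b A"] by (auto intro: span_add span_scale span_base)
      then show "x \<in> cball 0 r \<inter> span (insert b A)" using x by blast
    qed
    ultimately show ?thesis by (simp add: closed_Int_compact)
  qed
qed

lemma closed_span_finite: "finite A \<Longrightarrow> closed (span (A :: 'a::real_normed_vector set))"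
  by (rule closed_if_compact_cball) (rule compact_cball_span)

text \<open>The functional exists because a finite-dimensional subspace is closed, which bounds
  the coordinate along \<open>b\<close>.\<close>

lemma bounded_functional_separating_span:
  fixes A :: "'a::real_normed_vector set"
  assumes A: "finite A" and b: "b \<notin> span A"
  obtains \<xi> :: "'a \<Rightarrow> real" where "linear \<xi>" "\<And>x. \<bar>\<xi> x\<bar> \<le> norm x" "\<And>x. x \<in> span A \<Longrightarrow> \<xi> x = 0" "\<xi> b \<noteq> 0"
proof -
  obtain d where d: "0 < d" "\<And>t z. z \<in> span A \<Longrightarrow> \<bar>t\<bar> * d \<le> norm (t *\<^sub>R b + z)"
    using closed_subspace_coefficient_bound[OF subspace_span closed_span_finite[OF A] b] by blast
  obtain B where B: "B \<subseteq> span A" "independent B" "span A \<subseteq> span B"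
    using real_vector.basis_exists[of "span A"] by metis
  have spanB: "span B = span A"
    using B(1,3) by (metis span_minimal subspace_span subset_antisym)
  have ind: "independent (insert b B)" using b B(2) by (simp add: independent_insertI spanB)
  obtain f :: "'a \<Rightarrow> real" where f: "linear f" "\<And>x. x \<in> insert b B \<Longrightarrow> f x = (if x = b then d else 0)"
    using linear_independent_extend[OF ind, of "\<lambda>x. if x = b then d else 0"] by blast
  have "b \<notin> B" using b B(1) by blast
  then have fB: "f x = 0" if "x \<in> span A" for x
    using linear_eq_0_on_span[OF f(1), of B x] f(2) that spanB by fastforce
  have dom: "f s \<le> norm s" if "s \<in> span (insert b A)" for s
  proof -
    obtain t where t: "s - t *\<^sub>R b \<in> span A" using \<open>s \<in> _\<close> by (auto simp: span_breakdown_eq)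
    have "f s = t * d"
      using fB[OF t] f(2)[of b] by (simp add: linear_diff[OF f(1)] linear_scale[OF f(1)])
    also have "\<dots> \<le> \<bar>t\<bar> * d" using d(1) by (simp add: mult_right_mono)
    also have "\<dots> \<le> norm s" using d(2)[OF t, of t] by simp
    finally show ?thesis .
  qed
  obtain \<xi> where \<xi>: "linear \<xi>" "\<And>s. s \<in> span (insert b A) \<Longrightarrow> \<xi> s = f s" "\<And>x. \<xi> x \<le> norm x"
    by (rule Hahn_Banach_sublinear[OF seminorm_imp_sublinear[OF seminorm_norm] subspace_span f(1) dom],
        assumption, rule that)
  have "\<bar>\<xi> x\<bar> \<le> norm x" for x
    using \<xi>(3)[of x] linear_minus_le[OF \<xi>(1,3), of x] by simp
  moreover have "\<xi> x = 0" if "x \<in> span A" for x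
    using \<xi>(2)[of x] fB[OF that] that span_mono[of A "insert b A"] by auto
  moreover have "\<xi> b \<noteq> 0" using \<xi>(2)[of b] f(2)[of b] d(1) by (simp add: span_base)
  ultimately show ?thesis using that \<xi>(1) by blast
qed

lemma norming_functional:
  fixes u :: "'a::real_normed_vector"
  obtains \<phi> :: "'a \<Rightarrow> real" where "linear \<phi>" "\<And>x. \<bar>\<phi> x\<bar> \<le> norm x" "\<phi> u = norm u"
proof (cases "u = 0")
  case True
  then show ?thesis by (intro that[of "\<lambda>_. 0"]) (auto simp: linear_zero)
next
  case False
  then obtain f :: "'a \<Rightarrow> real" where f: "linear f" "f u = norm u"
    using linear_independent_extend[of "{u}" "\<lambda>_. norm u"] by auto
  have dom: "f s \<le> norm s" if "s \<in> span {u}" for s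
    using that f(2) by (auto simp: span_singleton linear_scale[OF f(1)] mult_right_mono)
  obtain \<phi> where \<phi>: "linear \<phi>" "\<And>s. s \<in> span {u} \<Longrightarrow> \<phi> s = f s" "\<And>x. \<phi> x \<le> norm x"
    by (rule Hahn_Banach_sublinear[OF seminorm_imp_sublinear[OF seminorm_norm] subspace_span f(1) dom],
        assumption, rule that)
  have "\<bar>\<phi> x\<bar> \<le> norm x" for x
    using \<phi>(3)[of x] linear_minus_le[OF \<phi>(1,3), of x] by simp
  then show ?thesis using that \<phi>(1) \<phi>(2)[of u] f(2) by (simp add: span_base)
qed

text \<open>Compactness of the unit sphere of the span reduces the Hahn--Banach functionals at all of its
  points to finitely many. The zero functional serves only to keep the set non-empty.\<close>

lemma finitely_many_almost_norming_functionals: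
  fixes A :: "'a::real_normed_vector set"
  assumes A: "finite A" and c: "c < 1"
  obtains F :: "('a \<Rightarrow> real) set" where "finite F" "F \<noteq> {}"
    "\<And>\<phi>. \<phi> \<in> F \<Longrightarrow> linear \<phi> \<and> (\<forall>x. \<bar>\<phi> x\<bar> \<le> norm x)"
    "\<And>x. x \<in> span A \<Longrightarrow> \<exists>\<phi>\<in>F. c * norm x \<le> \<bar>\<phi> x\<bar>"
proof -
  define \<Phi> :: "'a \<Rightarrow> 'a \<Rightarrow> real"
    where "\<Phi> u = (SOME \<phi>. linear \<phi> \<and> (\<forall>x. \<bar>\<phi> x\<bar> \<le> norm x) \<and> \<phi> u = norm u)" for u
  have \<Phi>: "linear (\<Phi> u)" "\<bar>\<Phi> u x\<bar> \<le> norm x" "\<Phi> u u = norm u" for u x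
  proof -
    have "\<exists>\<phi>. linear \<phi> \<and> (\<forall>x. \<bar>\<phi> x\<bar> \<le> norm x) \<and> \<phi> u = norm u"
      using norming_functional[of u] by metis
    from someI_ex[OF this] show "linear (\<Phi> u)" "\<bar>\<Phi> u x\<bar> \<le> norm x" "\<Phi> u u = norm u"
      unfolding \<Phi>_def by blast+
  qed
  have "closed (sphere (0::'a) 1)"
    unfolding sphere_def dist_norm by (intro closed_Collect_eq continuous_intros)
  then have "compact (sphere 0 1 \<inter> (cball 0 1 \<inter> span A))"
    by (rule closed_Int_compact) (rule compact_cball_span[OF A])
  moreover have "sphere 0 1 \<inter> (cball 0 1 \<inter> span A) = sphere 0 1 \<inter> span A" by auto
  ultimately have K: "compact (sphere 0 1 \<inter> span A)" by simp
  have cont: "continuous_on UNIV (\<Phi> u)" for u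
  proof -
    have "bounded_linear (\<Phi> u)"
      using \<Phi>(1,2) by (intro bounded_linear_intro[where K = 1]) (auto simp: linear_add linear_scale)
    then show ?thesis by (rule linear_continuous_on)
  qed
  have "open {x. c < \<Phi> u x}" for u
    by (intro open_Collect_less continuous_on_const cont)
  moreover have "sphere 0 1 \<inter> span A \<subseteq> (\<Union>u\<in>sphere 0 1 \<inter> span A. {x. c < \<Phi> u x})"
    using \<Phi>(3) c by auto
  ultimately obtain U where U: "U \<subseteq> sphere 0 1 \<inter> span A" "finite U"
      "sphere 0 1 \<inter> span A \<subseteq> (\<Union>u\<in>U. {x. c < \<Phi> u x})"
    by (rule compactE_image[OF K])
  show ?thesis
  proof (rule that[of "insert (\<lambda>_. 0) (\<Phi> ` U)"])
    show "\<exists>\<phi>\<in>insert (\<lambda>_. 0) (\<Phi> ` U). c * norm x \<le> \<bar>\<phi> x\<bar>" if x: "x \<in> span A" for x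
    proof (cases "x = 0")
      case False
      define y where "y = (1 / norm x) *\<^sub>R x"
      have xy: "x = norm x *\<^sub>R y" using False by (simp add: y_def)
      have "y \<in> sphere 0 1 \<inter> span A" using False x by (simp add: y_def span_scale)
      then obtain u where u: "u \<in> U" "c < \<Phi> u y" using U(3) by blast
      have "\<Phi> u x = norm x * \<Phi> u y" using linear_scale[OF \<Phi>(1), of u "norm x" y] xy by simp
      then have "c * norm x \<le> \<Phi> u x" using u(2) mult_left_mono[of c "\<Phi> u y" "norm x"] by (simp add: mult.commute)
      then show ?thesis using u(1) by (intro bexI[of _ "\<Phi> u"]) auto
    qed auto
  qed (use U(2) \<Phi>(1,2) in \<open>auto simp: linear_zero\<close>)
qed

section \<open>Minkowski's theorem without topology\<close>

lemma extreme_point_of_no_centred_segment: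
  assumes "x extreme_point_of C" "x + y \<in> C" "x - y \<in> C"
  shows "y = 0"
proof (rule ccontr)
  assume "y \<noteq> 0"
  have "x - y \<noteq> x + y"
  proof
    assume "x - y = x + y"
    then have "2 *\<^sub>R y = 0" by (simp add: scaleR_2 algebra_simps)
    then show False using \<open>y \<noteq> 0\<close> by simp
  qed
  then have "midpoint (x - y) (x + y) \<in> open_segment (x - y) (x + y)" by simp
  moreover have "midpoint (x - y) (x + y) = x" by (simp add: midpoint_def flip: scaleR_2)
  ultimately show False using assms by (auto simp: extreme_point_of_def)
qed

lemma extreme_point_ofI_no_centred_segment:
  assumes C: "convex C" and x: "x \<in> C" and seg: "\<And>y. x + y \<in> C \<Longrightarrow> x - y \<in> C \<Longrightarrow> y = 0"
  shows "x extreme_point_of C"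
  unfolding extreme_point_of_def
proof (intro conjI ballI notI x)
  fix a b assume ab: "a \<in> C" "b \<in> C" "x \<in> open_segment a b"
  then obtain u where u: "a \<noteq> b" "0 < u" "u < 1" "x = (1 - u) *\<^sub>R a + u *\<^sub>R b"
    by (auto simp: in_segment)
  define e where "e = min u (1 - u)"
  have e: "0 < e" "e \<le> u" "e \<le> 1 - u" using u by (auto simp: e_def)
  have "x + e *\<^sub>R (b - a) = (1 - (u + e)) *\<^sub>R a + (u + e) *\<^sub>R b"
    "x - e *\<^sub>R (b - a) = (1 - (u - e)) *\<^sub>R a + (u - e) *\<^sub>R b"
    by (simp_all add: u(4) algebra_simps)
  moreover have "(1 - (u + e)) *\<^sub>R a + (u + e) *\<^sub>R b \<in> C" "(1 - (u - e)) *\<^sub>R a + (u - e) *\<^sub>R b \<in> C"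
    using e u by (auto intro!: convexD_alt[OF C ab(1,2)])
  ultimately have "e *\<^sub>R (b - a) = 0" using seg[of "e *\<^sub>R (b - a)"] by (simp only:)
  then show False using e(1) u(1) by simp
qed

text \<open>The directions in which \<open>x\<close> is an interior point of a segment in \<open>C\<close>; for convex \<open>C\<close> they form
  the linear space parallel to the smallest face containing \<open>x\<close>.\<close>

definition segment_directions :: "'a::real_vector set \<Rightarrow> 'a \<Rightarrow> 'a set" where
  "segment_directions C x = {y. \<exists>t>0. x + t *\<^sub>R y \<in> C \<and> x - t *\<^sub>R y \<in> C}"

lemma between_in_convex:
  assumes C: "convex C" and x: "x \<in> C" "x + t *\<^sub>R y \<in> C" and s: "0 \<le> s" "s \<le> t"
  shows "x + s *\<^sub>R y \<in> C"
proof (cases "t = 0")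
  case False
  have "x + s *\<^sub>R y = (1 - s / t) *\<^sub>R x + (s / t) *\<^sub>R (x + t *\<^sub>R y)"
    using False by (simp add: algebra_simps)
  also have "\<dots> \<in> C" using s False by (intro convexD_alt[OF C x]) (auto simp: field_simps)
  finally show ?thesis .
qed (use s x in auto)

lemma subspace_segment_directions:
  assumes C: "convex C" and x: "x \<in> C"
  shows "subspace (segment_directions C x)"
proof (rule subspaceI)
  show "0 \<in> segment_directions C x" using x by (auto simp: segment_directions_def intro: exI[of _ 1])
next
  fix y z assume "y \<in> segment_directions C x" "z \<in> segment_directions C x"
  then obtain s t where s: "0 < s" "x + s *\<^sub>R y \<in> C" "x - s *\<^sub>R y \<in> C"
    and t: "0 < t" "x + t *\<^sub>R z \<in> C" "x - t *\<^sub>R z \<in> C" by (auto simp: segment_directions_def)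
  define r where "r = min s t"
  have r: "0 < r" "r \<le> s" "r \<le> t" using s t by (auto simp: r_def)
  have in_C: "x + r *\<^sub>R y \<in> C" "x + r *\<^sub>R z \<in> C" "x + r *\<^sub>R (- y) \<in> C" "x + r *\<^sub>R (- z) \<in> C"
    using between_in_convex[OF C x, of s y r] between_in_convex[OF C x, of t z r]
      between_in_convex[OF C x, of s "- y" r] between_in_convex[OF C x, of t "- z" r] r s t by auto
  have "x + (r / 2) *\<^sub>R (y + z) = (1 - 1 / 2) *\<^sub>R (x + r *\<^sub>R y) + (1 / 2) *\<^sub>R (x + r *\<^sub>R z)"
    "x - (r / 2) *\<^sub>R (y + z) = (1 - 1 / 2) *\<^sub>R (x + r *\<^sub>R (- y)) + (1 / 2) *\<^sub>R (x + r *\<^sub>R (- z))"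
    by (simp_all add: algebra_simps flip: scaleR_left_distrib)
  moreover have "(1 - 1 / 2) *\<^sub>R (x + r *\<^sub>R y) + (1 / 2) *\<^sub>R (x + r *\<^sub>R z) \<in> C"
    "(1 - 1 / 2) *\<^sub>R (x + r *\<^sub>R (- y)) + (1 / 2) *\<^sub>R (x + r *\<^sub>R (- z)) \<in> C"
    by (intro convexD_alt[OF C] in_C; simp)+
  ultimately show "y + z \<in> segment_directions C x"
    using r(1) unfolding segment_directions_def by (intro CollectI exI[of _ "r / 2"]) simp
next
  fix c y assume "y \<in> segment_directions C x"
  then obtain s where s: "0 < s" "x + s *\<^sub>R y \<in> C" "x - s *\<^sub>R y \<in> C" by (auto simp: segment_directions_def)
  show "c *\<^sub>R y \<in> segment_directions C x"
  proof (cases "c = 0")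
    case True
    then show ?thesis using x by (auto simp: segment_directions_def intro: exI[of _ 1])
  next
    case False
    then have "(s / \<bar>c\<bar>) *\<^sub>R c *\<^sub>R y = s *\<^sub>R y \<or> (s / \<bar>c\<bar>) *\<^sub>R c *\<^sub>R y = - (s *\<^sub>R y)"
      by (auto simp: abs_if)
    then show ?thesis
      using s False unfolding segment_directions_def
      by (intro CollectI exI[of _ "s / \<bar>c\<bar>"]) auto
  qed
qed

text \<open>Shrinking \<open>C\<close> towards the point \<open>x - s *\<^sub>R y\<close> until \<open>x + t *\<^sub>R y\<close> arrives at \<open>x\<close> carries the segments
  around \<open>x + t *\<^sub>R y\<close> to parallel segments around \<open>x\<close>.\<close>

lemma segment_directions_endpoint:
  assumes C: "convex C" and e: "x + t *\<^sub>R y \<in> C" and e': "x - s *\<^sub>R y \<in> C" and st: "0 < s" "0 \<le> t"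
  shows "segment_directions C (x + t *\<^sub>R y) \<subseteq> segment_directions C x"
proof
  fix z assume "z \<in> segment_directions C (x + t *\<^sub>R y)"
  then obtain r where r: "0 < r" "x + t *\<^sub>R y + r *\<^sub>R z \<in> C" "x + t *\<^sub>R y - r *\<^sub>R z \<in> C"
    by (auto simp: segment_directions_def)
  define l where "l = t / (s + t)"
  have l: "0 \<le> l" "l < 1" "(1 - l) * t = l * s" using st by (auto simp: l_def field_simps)
  have eq: "(1 - l) *\<^sub>R (x + t *\<^sub>R y + w) + l *\<^sub>R (x - s *\<^sub>R y) = x + (1 - l) *\<^sub>R w" for w
  proof -
    have "(1 - l) *\<^sub>R (x + t *\<^sub>R y + w) + l *\<^sub>R (x - s *\<^sub>R y)
        = x + ((1 - l) * t) *\<^sub>R y - (l * s) *\<^sub>R y + (1 - l) *\<^sub>R w" by (simp add: algebra_simps)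
    then show ?thesis by (simp add: l(3))
  qed
  have "x + (1 - l) *\<^sub>R (r *\<^sub>R z) \<in> C" "x + (1 - l) *\<^sub>R (- (r *\<^sub>R z)) \<in> C"
    using convexD_alt[OF C r(2) e', of l] convexD_alt[OF C r(3) e', of l] l(1,2)
      eq[of "r *\<^sub>R z"] eq[of "- (r *\<^sub>R z)"] by simp_all
  then show "z \<in> segment_directions C x"
    using l(2) r(1) unfolding segment_directions_def
    by (intro CollectI exI[of _ "(1 - l) * r"]) simp
qed

text \<open>A point of \<open>C\<close> that is not extreme lies between the two ends of a maximal segment of \<open>C\<close>. At each
  end the direction of that segment is no longer available, so that the dimension of the space of
  directions has dropped.\<close>

lemma Minkowski_finite_dimensional:
  fixes C :: "'a::real_vector set"
  assumes C: "convex C" and fin: "finite A" "C \<subseteq> span A"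
    and lines: "\<And>x y. x \<in> C \<Longrightarrow> y \<noteq> 0 \<Longrightarrow> compact {t. x + t *\<^sub>R y \<in> C}"
  shows "C \<subseteq> convex hull {x. x extreme_point_of C}"
proof -
  have bound: "finite I \<and> card I \<le> card A"
    if I: "independent I" "I \<subseteq> segment_directions C x" and x: "x \<in> C" for I x
  proof -
    have "segment_directions C x \<subseteq> span A"
    proof
      fix y assume "y \<in> segment_directions C x"
      then obtain t where t: "0 < t" "x + t *\<^sub>R y \<in> C" by (auto simp: segment_directions_def)
      then have "(1 / t) *\<^sub>R ((x + t *\<^sub>R y) - x) \<in> span A"
        using fin(2) x by (intro span_scale span_diff) auto
      then show "y \<in> span A" using t(1) by simp
    qed
    then show ?thesis using independent_span_bound[OF fin(1) I(1)] I(2) by blast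
  qed
  \<comment> \<open>The induction runs over a bound for the size of independent sets of directions.\<close>
  have main: "x \<in> convex hull {x. x extreme_point_of C}"
    if "x \<in> C" and "\<And>I. independent I \<Longrightarrow> I \<subseteq> segment_directions C x \<Longrightarrow> card I \<le> k" for x k
    using that
  proof (induction k arbitrary: x)
    case 0
    have "y = 0" if "x + y \<in> C" "x - y \<in> C" for y
    proof (rule ccontr)
      assume "y \<noteq> 0"
      then have "independent {y}" by simp
      moreover have "{y} \<subseteq> segment_directions C x"
        using that by (auto simp: segment_directions_def intro: exI[of _ 1])
      ultimately show False using "0.prems"(2)[of "{y}"] by simp
    qed
    then have "x extreme_point_of C" using C "0.prems"(1) by (intro extreme_point_ofI_no_centred_segment)
    then show ?case by (simp add: hull_inc)
  next
    case (Suc k)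
    show ?case
    proof (cases "x extreme_point_of C")
      case True
      then show ?thesis by (simp add: hull_inc)
    next
      case False
      then obtain y where y: "y \<noteq> 0" "x + y \<in> C" "x - y \<in> C"
        using extreme_point_ofI_no_centred_segment[OF C Suc.prems(1)] by blast
      have y_dir: "y \<in> segment_directions C x"
        using y by (auto simp: segment_directions_def intro: exI[of _ 1])
      have endpoint: "\<exists>t\<ge>1. x + t *\<^sub>R v \<in> convex hull {x. x extreme_point_of C}"
        if v: "v \<noteq> 0" "x + v \<in> C" "x - v \<in> C" "v \<in> segment_directions C x" for v
      proof -
        have one: "1 \<in> {t. x + t *\<^sub>R v \<in> C}" using v(2) by simp
        obtain t where t: "x + t *\<^sub>R v \<in> C" "\<And>s. x + s *\<^sub>R v \<in> C \<Longrightarrow> s \<le> t"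
          using compact_attains_sup[OF lines[OF Suc.prems(1) v(1)]] one by blast
        have t1: "1 \<le> t" using t(2)[of 1] v(2) by simp
        let ?D = "segment_directions C (x + t *\<^sub>R v)"
        have sub: "?D \<subseteq> segment_directions C x"
          using segment_directions_endpoint[OF C t(1), of 1] v(3) t1 by simp
        have v_notin: "v \<notin> ?D"
        proof
          assume "v \<in> ?D"
          then obtain s where "0 < s" "x + (t + s) *\<^sub>R v \<in> C"
            by (auto simp: segment_directions_def algebra_simps)
          then show False using t(2) by fastforce
        qed
        have "card I \<le> k" if I: "independent I" "I \<subseteq> ?D" for I
        proof -
          have "span I \<subseteq> ?D" using I(2) subspace_segment_directions[OF C t(1)] by (rule span_minimal)
          then have vI: "v \<notin> span I" using v_notin by blast
          then have "independent (insert v I)" using I(1) by (rule independent_insertI)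
          moreover have "insert v I \<subseteq> segment_directions C x" using I(2) sub v(4) by blast
          ultimately have "card (insert v I) \<le> Suc k" by (rule Suc.prems(2))
          moreover have "v \<notin> I" using vI span_base by blast
          ultimately show ?thesis using bound[OF I t(1)] by simp
        qed
        then have "x + t *\<^sub>R v \<in> convex hull {x. x extreme_point_of C}" by (rule Suc.IH[OF t(1)])
        then show ?thesis using t1 by blast
      qed
      obtain t where t: "1 \<le> t" "x + t *\<^sub>R y \<in> convex hull {x. x extreme_point_of C}"
        using endpoint[OF y y_dir] by blast
      have "- y \<in> segment_directions C x"
        by (rule subspace_neg[OF subspace_segment_directions[OF C Suc.prems(1)] y_dir])
      then obtain s where s: "1 \<le> s" "x + s *\<^sub>R (- y) \<in> convex hull {x. x extreme_point_of C}"
        using endpoint[of "- y"] y by auto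
      have coeff: "(1 - t / (s + t)) * t = t / (s + t) * s" using s t by (simp add: field_simps)
      have "(1 - t / (s + t)) *\<^sub>R (x + t *\<^sub>R y) + (t / (s + t)) *\<^sub>R (x + s *\<^sub>R (- y))
          = x + ((1 - t / (s + t)) * t) *\<^sub>R y - (t / (s + t) * s) *\<^sub>R y"
        by (simp add: algebra_simps)
      also have "\<dots> = x" by (simp add: coeff)
      finally show ?thesis
        using convexD_alt[OF convex_convex_hull t(2) s(2), of "t / (s + t)"] s t by simp
    qed
  qed
  show ?thesis
  proof
    fix x assume x: "x \<in> C"
    show "x \<in> convex hull {x. x extreme_point_of C}"
      using bound[OF _ _ x] by (intro main[OF x]) blast
  qed
qed

section \<open>A norm that is locally a maximum of finitely many layers\<close>

text \<open>Layer \<open>n\<close> of the norm will be at most \<open>layer_weight n + (1/2)\<^sup>n / 4 = 1 + (1/2)\<^sup>n\<close> times the given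
  norm, and at least \<open>norming_factor n\<close> times it on \<open>X n\<close>. The constants are chosen such that
  \<open>1 + (1/2)\<^bsup>n+1\<^esup> < norming_factor n < layer_weight n\<close>: the first inequality makes all layers after \<open>n\<close>
  strictly smaller than layer \<open>n\<close> on \<open>X n\<close>, the second leaves room to norm \<open>X n\<close> by finitely many
  functionals only.\<close>

definition layer_weight :: "nat \<Rightarrow> real" where
  "layer_weight n = 1 + 3/4 * (1/2) ^ n"

definition norming_factor :: "nat \<Rightarrow> real" where
  "norming_factor n = 1 + 5/8 * (1/2) ^ n"

text \<open>\<open>X\<close> is the filtration by the spans of the first \<open>n\<close> basis vectors and \<open>\<xi> n\<close> vanishes on \<open>X n\<close> but
  detects the step to \<open>X (Suc n)\<close>. These triangular functionals replace the biorthogonal coordinate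
  functionals, which need not be continuous.\<close>

locale layered_norm =
  fixes X :: "nat \<Rightarrow> 'a::real_normed_vector set"
    and \<xi> :: "nat \<Rightarrow> 'a \<Rightarrow> real"
    and F :: "nat \<Rightarrow> ('a \<Rightarrow> real) set"
  assumes X_subspace: "subspace (X n)"
    and X_mono: "m \<le> n \<Longrightarrow> X m \<subseteq> X n"
    and X_cover: "\<exists>n. x \<in> X n"
    and X_proper: "X n \<noteq> UNIV"
    and X_finite_dim: "\<exists>A. finite A \<and> X n = span A"
    and \<xi>_linear: "linear (\<xi> n)"
    and \<xi>_bounded: "\<bar>\<xi> n x\<bar> \<le> norm x"
    and \<xi>_zero: "x \<in> X n \<Longrightarrow> \<xi> n x = 0"
    and \<xi>_nonzero: "x \<in> X (Suc n) \<Longrightarrow> x \<notin> X n \<Longrightarrow> \<xi> n x \<noteq> 0"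
    and F_finite: "finite (F n)" and F_nonempty: "F n \<noteq> {}"
    and F_linear: "\<phi> \<in> F n \<Longrightarrow> linear \<phi>"
    and F_bounded: "\<phi> \<in> F n \<Longrightarrow> \<bar>\<phi> x\<bar> \<le> norm x"
    and F_norming: "x \<in> X n \<Longrightarrow> \<exists>\<phi>\<in>F n. norming_factor n * norm x \<le> layer_weight n * \<bar>\<phi> x\<bar>"
begin

definition tail :: "nat \<Rightarrow> 'a \<Rightarrow> real" where
  "tail n x = (\<Sum>m. (1/2) ^ Suc (m + n) * \<bar>\<xi> (m + n) x\<bar>)"

definition core :: "nat \<Rightarrow> 'a \<Rightarrow> real" where
  "core n x = Max ((\<lambda>\<phi>. layer_weight n * \<bar>\<phi> x\<bar>) ` F n)"

definition layer :: "nat \<Rightarrow> 'a \<Rightarrow> real" where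
  "layer n x = core n x + (1/2) ^ n / 4 * tail n x"

definition N :: "'a \<Rightarrow> real" where
  "N x = (SUP n. layer n x)"

definition near :: "nat \<Rightarrow> 'a \<Rightarrow> real" where
  "near n x = Max ((\<lambda>j. layer j x) ` {..n})"

definition far :: "nat \<Rightarrow> 'a \<Rightarrow> real" where
  "far n x = (SUP j\<in>{n<..}. layer j x)"

lemma tail_term_le: "(1/2) ^ Suc (m + n) * \<bar>\<xi> (m + n) x\<bar> \<le> (1/2) ^ Suc m * norm x"
proof -
  have "(1/2 :: real) ^ Suc (m + n) \<le> (1/2) ^ Suc m" by (rule power_decreasing) auto
  then show ?thesis by (intro mult_mono \<xi>_bounded) auto
qed

lemma sums_halves_norm: "(\<lambda>m. (1/2) ^ Suc m * norm (x :: 'a)) sums norm x"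
  using sums_mult2[OF power_half_series, of "norm x"] by simp

lemma tail_summable: "summable (\<lambda>m. (1/2) ^ Suc (m + n) * \<bar>\<xi> (m + n) x\<bar>)"
  using tail_term_le by (intro summable_comparison_test'[OF sums_summable[OF sums_halves_norm[of x]], of 0]) simp

lemma tail_le_norm: "tail n x \<le> norm x"
proof -
  have "tail n x \<le> (\<Sum>m. (1/2) ^ Suc m * norm x)"
    unfolding tail_def
    by (rule suminf_le[OF tail_term_le tail_summable sums_summable[OF sums_halves_norm]])
  then show ?thesis unfolding sums_unique[OF sums_halves_norm[of x], symmetric] .
qed

lemma tail_nonneg: "0 \<le> tail n x"
  unfolding tail_def by (rule suminf_nonneg[OF tail_summable]) simp

lemma tail_ge_term: "n \<le> m \<Longrightarrow> (1/2) ^ Suc m * \<bar>\<xi> m x\<bar> \<le> tail n x"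
  unfolding tail_def
  using sum_le_suminf[OF tail_summable, of "{m - n}" n x] by simp

lemma seminorm_tail: "seminorm (tail n)"
proof (rule seminormI)
  fix x y
  have "tail n (x + y) \<le>
      (\<Sum>m. (1/2) ^ Suc (m + n) * \<bar>\<xi> (m + n) x\<bar> + (1/2) ^ Suc (m + n) * \<bar>\<xi> (m + n) y\<bar>)"
    unfolding tail_def
  proof (rule suminf_le[OF _ tail_summable summable_add[OF tail_summable tail_summable]])
    fix m
    have "\<bar>\<xi> (m + n) (x + y)\<bar> \<le> \<bar>\<xi> (m + n) x\<bar> + \<bar>\<xi> (m + n) y\<bar>"
      by (simp add: linear_add[OF \<xi>_linear])
    then show "(1/2) ^ Suc (m + n) * \<bar>\<xi> (m + n) (x + y)\<bar> \<le>
        (1/2) ^ Suc (m + n) * \<bar>\<xi> (m + n) x\<bar> + (1/2) ^ Suc (m + n) * \<bar>\<xi> (m + n) y\<bar>"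
      by (simp only: flip: distrib_left) (simp add: mult_left_mono)
  qed
  also have "\<dots> = tail n x + tail n y"
    unfolding tail_def by (rule suminf_add[OF tail_summable tail_summable, symmetric])
  finally show "tail n (x + y) \<le> tail n x + tail n y" .
next
  fix c x
  have "tail n (c *\<^sub>R x) = (\<Sum>m. \<bar>c\<bar> * ((1/2) ^ Suc (m + n) * \<bar>\<xi> (m + n) x\<bar>))"
    unfolding tail_def by (simp add: linear_scale[OF \<xi>_linear] abs_mult algebra_simps)
  then show "tail n (c *\<^sub>R x) = \<bar>c\<bar> * tail n x"
    unfolding tail_def by (simp only: suminf_mult[OF tail_summable])
qed

lemma \<xi>_vanishes: "x \<in> X n \<Longrightarrow> n \<le> m \<Longrightarrow> \<xi> m x = 0"
  using X_mono \<xi>_zero by blast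

lemma tail_vanishes: "x \<in> X n \<Longrightarrow> n \<le> m \<Longrightarrow> tail m x = 0"
  unfolding tail_def using \<xi>_vanishes[of x n] by simp

lemma tail_Suc: "tail n x = (1/2) ^ Suc n * \<bar>\<xi> n x\<bar> + tail (Suc n) x"
  unfolding tail_def using suminf_split_head[OF tail_summable, of n x] by simp

text \<open>Take the last step of the filtration needed to reach \<open>y\<close>.\<close>

lemma nonzero_kink_off_X:
  assumes "y \<notin> X n"
  obtains m where "n \<le> m" "\<xi> m y \<noteq> 0"
proof -
  define k where "k = (LEAST k. y \<in> X k)"
  have k: "y \<in> X k" unfolding k_def by (rule LeastI_ex[OF X_cover])
  have nk: "n < k"
  proof (rule ccontr)
    assume "\<not> n < k"
    then show False using k X_mono[of k n] assms by auto
  qed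
  then obtain m where m: "k = Suc m" by (cases k) auto
  have "y \<notin> X m" using not_less_Least[of m "\<lambda>k. y \<in> X k"] m by (simp add: k_def)
  then have "\<xi> m y \<noteq> 0" using \<xi>_nonzero k m by blast
  then show ?thesis using that[of m] nk m by simp
qed

lemma seminorm_scaled_tail: "0 \<le> c \<Longrightarrow> seminorm (\<lambda>x. c * tail n x)"
  by (rule seminormI)
    (simp_all add: seminorm_scale[OF seminorm_tail] seminorm_add[OF seminorm_tail] mult_left_mono
      mult.left_commute flip: distrib_left)

lemma layer_weight_nonneg: "0 \<le> layer_weight n" by (simp add: layer_weight_def)

lemma seminorm_core: "seminorm (core n)"
  unfolding core_def
  by (rule seminorm_Max[OF F_finite F_nonempty])
    (simp add: seminorm_abs_linear F_linear layer_weight_nonneg)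

lemma seminorm_layer: "seminorm (layer n)"
  unfolding layer_def by (intro seminorm_sum_of_two seminorm_core seminorm_scaled_tail) simp

lemma core_ge: "\<phi> \<in> F n \<Longrightarrow> layer_weight n * \<bar>\<phi> x\<bar> \<le> core n x"
  unfolding core_def by (rule Max_ge[OF finite_imageI[OF F_finite] imageI])

lemma core_le: "core n x \<le> layer_weight n * norm x"
  unfolding core_def
  using F_finite F_nonempty F_bounded layer_weight_nonneg by (simp add: mult_left_mono)

lemma layer_le: "layer n x \<le> (1 + (1/2) ^ n) * norm x"
proof -
  have "(1/2) ^ n / 4 * tail n x \<le> (1/2) ^ n / 4 * norm x"
    by (intro mult_left_mono tail_le_norm) simp
  then show ?thesis
    unfolding layer_def using core_le[of n x] unfolding layer_weight_def distrib_right by linarith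
qed

lemma layer_le_twice: "layer n x \<le> 2 * norm x"
proof -
  have "(1 + (1/2) ^ n) * norm x \<le> 2 * norm x"
    by (intro mult_right_mono) (simp_all add: power_le_one)
  then show ?thesis using layer_le[of n x] by linarith
qed

lemma layer_ge: "x \<in> X n \<Longrightarrow> norming_factor n * norm x \<le> layer n x"
proof -
  assume "x \<in> X n"
  then obtain \<phi> where \<phi>: "\<phi> \<in> F n" "norming_factor n * norm x \<le> layer_weight n * \<bar>\<phi> x\<bar>"
    using F_norming by blast
  moreover have "0 \<le> (1/2) ^ n / 4 * tail n x" using tail_nonneg by simp
  ultimately show ?thesis unfolding layer_def using core_ge[OF \<phi>(1), of x] by linarith
qed

lemma bdd_above_layers: "bdd_above ((\<lambda>j. layer j x) ` J)"
  by (rule bdd_aboveI2) (rule layer_le_twice)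

lemma layer_le_N: "layer n x \<le> N x"
  unfolding N_def by (rule cSUP_upper[OF _ bdd_above_layers]) simp

lemma N_le_twice: "N x \<le> 2 * norm x"
  unfolding N_def by (rule cSUP_least) (simp_all add: layer_le_twice)

lemma norm_le_N: "norm x \<le> N x"
proof -
  obtain n where n: "x \<in> X n" using X_cover by blast
  have "1 * norm x \<le> norming_factor n * norm x"
    by (intro mult_right_mono) (simp_all add: norming_factor_def)
  then show ?thesis using layer_ge[OF n] layer_le_N[of n x] by linarith
qed

lemma seminorm_N: "seminorm N"
  unfolding N_def by (rule seminorm_SUP) (simp_all add: seminorm_layer bdd_above_layers)

lemma seminorm_far: "seminorm (far n)"
  unfolding far_def by (rule seminorm_SUP) (simp_all add: seminorm_layer bdd_above_layers)

lemma seminorm_near: "seminorm (near n)"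
  unfolding near_def by (rule seminorm_Max) (simp_all add: seminorm_layer)

lemma N_eq_near_far: "N = (\<lambda>x. max (near n x) (far n x))"
proof
  fix x
  have near: "layer j x \<le> near n x" if "j \<le> n" for j
    unfolding near_def using that by simp
  have far: "layer j x \<le> far n x" if "n < j" for j
    unfolding far_def by (rule cSUP_upper[OF _ bdd_above_layers]) (simp add: that)
  have "layer j x \<le> max (near n x) (far n x)" for j
    using near[of j] far[of j] by linarith
  then have "N x \<le> max (near n x) (far n x)" unfolding N_def by (intro cSUP_least) auto
  moreover have "near n x \<le> N x" unfolding near_def by (simp add: layer_le_N)
  moreover have "far n x \<le> N x" unfolding far_def by (rule cSUP_least) (simp_all add: layer_le_N)
  ultimately show "N x = max (near n x) (far n x)" by simp
qed

text \<open>The gap between consecutive layers: at a point of \<open>X n\<close> only the layers up to \<open>n\<close> count.\<close>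

lemma far_less_N:
  assumes x: "x \<in> X n" "x \<noteq> 0"
  shows "far n x < N x"
proof -
  have "far n x \<le> (1 + (1/2) ^ Suc n) * norm x"
    unfolding far_def
  proof (rule cSUP_least)
    fix j assume "j \<in> {n<..}"
    then have "(1/2 :: real) ^ j \<le> (1/2) ^ Suc n" by (intro power_decreasing) auto
    then have "(1 + (1/2) ^ j) * norm x \<le> (1 + (1/2) ^ Suc n) * norm x" by (intro mult_right_mono) auto
    then show "layer j x \<le> (1 + (1/2) ^ Suc n) * norm x" using layer_le[of j x] by linarith
  qed auto
  also have "\<dots> < norming_factor n * norm x"
    using x(2) by (intro mult_strict_right_mono) (simp_all add: norming_factor_def)
  also have "\<dots> \<le> N x" using layer_ge[OF x(1)] layer_le_N[of n x] by linarith
  finally show ?thesis .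
qed

lemma norming_layer:
  assumes x: "x \<in> X n" "x \<noteq> 0"
  obtains j where "j \<le> n" "layer j x = N x"
proof -
  have "near n x = N x" using far_less_N[OF x] fun_cong[OF N_eq_near_far, of x n] by linarith
  moreover have "near n x \<in> (\<lambda>j. layer j x) ` {..n}" unfolding near_def by (rule Max_in) auto
  ultimately show ?thesis using that by auto
qed

lemma tail_split:
  "j \<le> n \<Longrightarrow> tail j x = (\<Sum>i=j..<n. (1/2) ^ Suc i * \<bar>\<xi> i x\<bar>) + tail n x"
proof (induction n rule: dec_induct)
  case (step k)
  then show ?case by (simp add: tail_Suc[of k])
qed simp

text \<open>Near a point of \<open>X n\<close> every norming layer contains a term \<open>\<bar>\<xi> m y\<bar>\<close> with a kink at that point,
  so that no segment through it leaves \<open>X n\<close> and stays in the ball.\<close>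

lemma segment_in_ball_stays_in_X:
  assumes x: "x \<in> X n" "N x = 1" and y: "N (x + y) \<le> 1" "N (x - y) \<le> 1"
  shows "y \<in> X n"
proof (rule ccontr)
  assume "y \<notin> X n"
  then obtain m where m: "n \<le> m" "\<xi> m y \<noteq> 0" by (rule nonzero_kink_off_X)
  have "x \<noteq> 0" using x(2) seminorm_zero[OF seminorm_N] by auto
  then obtain j where j: "j \<le> n" "layer j x = 1" using norming_layer[OF x(1)] x(2) by metis
  let ?H = "\<lambda>w. \<Sum>i=j..<n. (1/2) ^ Suc i * \<bar>\<xi> i w\<bar>"
  have "2 * ?H x \<le> ?H (x + y) + ?H (x - y)"
    unfolding sum_distrib_left sum.distrib[symmetric]
  proof (rule sum_mono)
    fix i
    have "2 * \<bar>\<xi> i x\<bar> \<le> \<bar>\<xi> i (x + y)\<bar> + \<bar>\<xi> i (x - y)\<bar>"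
      by (simp add: linear_add[OF \<xi>_linear] linear_diff[OF \<xi>_linear])
    then have "(1/2) ^ Suc i * (2 * \<bar>\<xi> i x\<bar>) \<le> (1/2) ^ Suc i * (\<bar>\<xi> i (x + y)\<bar> + \<bar>\<xi> i (x - y)\<bar>)"
      by (rule mult_left_mono) simp
    then show "2 * ((1/2) ^ Suc i * \<bar>\<xi> i x\<bar>) \<le>
        (1/2) ^ Suc i * \<bar>\<xi> i (x + y)\<bar> + (1/2) ^ Suc i * \<bar>\<xi> i (x - y)\<bar>"
      by (simp only: distrib_left mult.left_commute)
  qed
  moreover have "tail n (x + y) = tail n y" "tail n (x - y) = tail n y"
    unfolding tail_def using \<xi>_vanishes[OF x(1)]
    by (simp_all add: linear_add[OF \<xi>_linear] linear_diff[OF \<xi>_linear])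
  moreover have "0 < tail n y"
  proof -
    have "0 < (1/2) ^ Suc m * \<bar>\<xi> m y\<bar>" using m(2) by simp
    then show ?thesis using tail_ge_term[OF m(1), of y] by linarith
  qed
  ultimately have "2 * tail j x < tail j (x + y) + tail j (x - y)"
    unfolding tail_split[OF j(1)] using tail_vanishes[OF x(1), of n] by simp
  then have "(1/2) ^ j / 4 * (2 * tail j x) < (1/2) ^ j / 4 * (tail j (x + y) + tail j (x - y))"
    by (rule mult_strict_left_mono) simp
  moreover have "2 * core j x \<le> core j (x + y) + core j (x - y)"
    using seminorm_add[OF seminorm_core, of j "x + y" "x - y"] seminorm_scale[OF seminorm_core, of j 2 x]
    by (simp add: scaleR_2)
  ultimately have "2 * layer j x < layer j (x + y) + layer j (x - y)"
    unfolding layer_def distrib_left by linarith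
  then show False using j(2) y layer_le_N[of j "x + y"] layer_le_N[of j "x - y"] by linarith
qed

lemma finite_values_tail:
  assumes c: "0 \<le> c" and x: "x \<in> X n" and j: "j \<le> n"
  shows "finite_values (\<lambda>x. c * tail j x) x"
  using j
proof (induction j rule: inc_induct)
  case base
  show ?case using seminorm_scaled_tail[OF c] tail_vanishes[OF x] by (intro finite_values_null) auto
next
  case (step k)
  have "(\<lambda>x. c * tail k x) = (\<lambda>x. (c * (1/2) ^ Suc k) * \<bar>\<xi> k x\<bar> + c * tail (Suc k) x)"
    by (simp only: tail_Suc[of k] distrib_left mult.assoc)
  moreover have "0 \<le> c * (1/2) ^ Suc k" using c by simp
  ultimately show ?case
    using step.IH seminorm_scaled_tail[OF c]
    by (simp only: finite_values_sum_of_two seminorm_abs_linear finite_values_abs_linear \<xi>_linear)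
qed

text \<open>On \<open>X n\<close> the infinite sums in the layers \<open>j \<le> n\<close> have only finitely many terms, so that \<open>near n\<close>
  is built there from finitely many functionals by sums and maxima.\<close>

lemma finite_values_near:
  assumes x: "x \<in> X n"
  shows "finite_values (near n) x"
proof -
  have "finite_values (layer j) x" if "j \<le> n" for j
    unfolding layer_def
  proof (rule finite_values_sum_of_two)
    show "finite_values (core j) x"
      unfolding core_def
      by (rule finite_values_Max[OF F_finite F_nonempty])
        (simp_all add: seminorm_abs_linear finite_values_abs_linear F_linear layer_weight_nonneg)
  qed (rule seminorm_core seminorm_scaled_tail finite_values_tail[OF _ x that]; simp)+
  then show ?thesis unfolding near_def by (intro finite_values_Max) (auto simp: seminorm_layer)
qed

text \<open>An extreme functional of \<open>N\<close> is one of \<open>near n\<close>, with finitely many values at \<open>x\<close>, or it is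
  dominated by \<open>far n\<close>, which is below 1 at \<open>x\<close>.\<close>

lemma extreme_functional_value_gap:
  assumes x: "N x = 1"
  obtains r where "r < 1" "\<And>f. extreme_functional N f \<Longrightarrow> f x \<noteq> 1 \<Longrightarrow> f x \<le> r"
proof -
  obtain n where n: "x \<in> X n" using X_cover by blast
  have "x \<noteq> 0" using x seminorm_zero[OF seminorm_N] by auto
  then have far: "far n x < 1" using far_less_N[OF n] x by simp
  define T where "T = insert (far n x) {v \<in> {f x | f. extreme_functional (near n) f}. v < 1}"
  have T: "finite T" "T \<noteq> {}" "\<And>v. v \<in> T \<Longrightarrow> v < 1"
    using finite_values_near[OF n] far unfolding T_def finite_values_def by auto
  show ?thesis
  proof (rule that[of "Max T"])
    show "Max T < 1" using T by simp
    fix f assume f: "extreme_functional N f" "f x \<noteq> 1"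
    have "extreme_functional (near n) f \<or> extreme_functional (far n) f"
      using f(1) unfolding N_eq_near_far[of n]
      by (rule extreme_functional_max[OF _ seminorm_near seminorm_far])
    moreover have "f x < 1" using extreme_functional_le[OF f(1), of x] f(2) x by simp
    ultimately have "f x \<in> T \<or> f x \<le> far n x" using extreme_functional_le by (auto simp: T_def)
    moreover have "far n x \<le> Max T" using T(1) by (simp add: T_def)
    moreover have "f x \<in> T \<Longrightarrow> f x \<le> Max T" using T(1) by simp
    ultimately show "f x \<le> Max T" by linarith
  qed
qed

lemma is_norm_N: "is_norm N"
  unfolding is_norm_def
proof (intro conjI allI)
  fix x
  show "N x = 0 \<longleftrightarrow> x = 0" using norm_le_N[of x] seminorm_zero[OF seminorm_N] by auto
qed (simp_all add: seminorm_nonneg seminorm_add seminorm_scale seminorm_N)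

lemma equivalent_norm_N: "equivalent_norm N"
  unfolding equivalent_norm_def
  using is_norm_N norm_le_N N_le_twice by (intro conjI exI[of _ 1] exI[of _ 2]) auto

end

section \<open>Balls and dual balls of equivalent norms\<close>

lemma equivalent_norm_seminorm: "equivalent_norm N \<Longrightarrow> seminorm N"
  by (auto simp: equivalent_norm_def is_norm_def seminorm_def)

lemma equivalent_norm_bdd_dual:
  fixes f :: "'a::real_normed_vector \<Rightarrow>\<^sub>L real"
  assumes "equivalent_norm N"
  shows "bdd_above ((\<lambda>x. \<bar>blinfun_apply f x\<bar>) ` unit_ball N)"
proof -
  obtain c where c: "0 < c" "\<And>x. c * norm x \<le> N x" using assms by (auto simp: equivalent_norm_def)
  have "\<bar>blinfun_apply f x\<bar> \<le> norm f * (1 / c)" if "x \<in> unit_ball N" for x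
  proof -
    have "c * norm x \<le> 1" using c(2)[of x] that by (simp add: unit_ball_def)
    then have "norm x \<le> 1 / c" using c(1) by (simp add: field_simps)
    then have "norm f * norm x \<le> norm f * (1 / c)" by (rule mult_left_mono) simp
    then show ?thesis using norm_blinfun[of f x] by simp
  qed
  then show ?thesis by (rule bdd_aboveI2)
qed

lemma dual_norm_le_one_iff:
  assumes N: "equivalent_norm N"
  shows "dual_norm N f \<le> 1 \<longleftrightarrow> (\<forall>x. blinfun_apply f x \<le> N x)"
proof
  note semi = equivalent_norm_seminorm[OF N]
  assume le: "dual_norm N f \<le> 1"
  have ball: "\<bar>blinfun_apply f x\<bar> \<le> 1" if "N x \<le> 1" for x
    using cSUP_upper[OF _ equivalent_norm_bdd_dual[OF N], of x f] le that
    by (simp add: dual_norm_def unit_ball_def)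
  show "\<forall>x. blinfun_apply f x \<le> N x"
  proof
    fix x
    show "blinfun_apply f x \<le> N x"
    proof (cases "x = 0")
      case False
      then have pos: "0 < N x"
        using N seminorm_nonneg[OF semi, of x] by (auto simp: equivalent_norm_def is_norm_def order_less_le)
      have "\<bar>blinfun_apply f ((1 / N x) *\<^sub>R x)\<bar> \<le> 1"
        using pos by (intro ball) (simp add: seminorm_scale[OF semi])
      then show ?thesis using pos by (simp add: blinfun.scaleR_right field_simps)
    qed (simp add: seminorm_zero[OF semi] blinfun.zero_right)
  qed
next
  note semi = equivalent_norm_seminorm[OF N]
  assume le: "\<forall>x. blinfun_apply f x \<le> N x"
  have "\<bar>blinfun_apply f x\<bar> \<le> N x" for x
    using le[rule_format, of x] le[rule_format, of "- x"] seminorm_minus[OF semi, of x]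
    by (simp add: blinfun.minus_right)
  moreover have "unit_ball N \<noteq> {}" using seminorm_zero[OF semi] by (auto simp: unit_ball_def intro: exI[of _ 0])
  ultimately show "dual_norm N f \<le> 1"
    unfolding dual_norm_def by (intro cSUP_least) (auto simp: unit_ball_def intro: order_trans)
qed

lemma dual_norm_eq_one:
  assumes N: "equivalent_norm N" and f: "dual_norm N f \<le> 1" and x: "N x = 1" "blinfun_apply f x = 1"
  shows "dual_norm N f = 1"
proof -
  have "1 \<le> dual_norm N f"
    unfolding dual_norm_def
    using cSUP_upper[OF _ equivalent_norm_bdd_dual[OF N], of x f] x by (simp add: unit_ball_def)
  then show ?thesis using f by simp
qed

text \<open>A linear perturbation admissible for an element of the dual ball is bounded by a multiple of the
  norm, so it is itself an element of the dual.\<close>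

lemma extreme_point_of_dual_ball:
  assumes N: "equivalent_norm N" and f: "f \<in> ext (unit_ball (dual_norm N))"
  shows "extreme_functional N (blinfun_apply f)"
  unfolding extreme_functional_def
proof (intro conjI allI impI)
  have f_ball: "f extreme_point_of unit_ball (dual_norm N)" using f by (simp add: ext_def)
  then have f_le: "dual_norm N f \<le> 1" by (simp add: extreme_point_of_def unit_ball_def)
  show "linear (blinfun_apply f)" by (simp add: blinfun.bounded_linear_right bounded_linear.linear)
  show le: "blinfun_apply f x \<le> N x" for x using f_le dual_norm_le_one_iff[OF N] by blast
  fix g x
  assume g: "linear g" and seg: "\<forall>x. blinfun_apply f x + g x \<le> N x \<and> blinfun_apply f x - g x \<le> N x"
  obtain C where C: "\<And>x. N x \<le> C * norm x" using N by (auto simp: equivalent_norm_def)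
  have "\<bar>g x\<bar> \<le> norm x * (C + norm f)" for x
  proof -
    have "\<bar>blinfun_apply f x\<bar> \<le> norm f * norm x" using norm_blinfun[of f x] by simp
    then have "\<bar>g x\<bar> \<le> C * norm x + norm f * norm x"
      using seg[rule_format, of x] C[of x] by linarith
    then show ?thesis by (simp add: algebra_simps)
  qed
  then have "bounded_linear g"
    using g by (intro bounded_linear_intro[where K = "C + norm f"]) (auto simp: linear_add linear_scale)
  then have G: "blinfun_apply (Blinfun g) = g" by (rule bounded_linear_Blinfun_apply)
  have "f + Blinfun g \<in> unit_ball (dual_norm N)" "f - Blinfun g \<in> unit_ball (dual_norm N)"
    using seg by (simp_all add: unit_ball_def dual_norm_le_one_iff[OF N] blinfun.add_left blinfun.diff_left G)
  then have "Blinfun g = 0" by (rule extreme_point_of_no_centred_segment[OF f_ball])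
  then show "g x = 0" using G by (metis blinfun.zero_left)
qed

lemma convex_unit_ball:
  assumes "seminorm N"
  shows "convex (unit_ball N)"
proof (rule convexI)
  fix x y and u v :: real
  assume x: "x \<in> unit_ball N" "y \<in> unit_ball N" and uv: "0 \<le> u" "0 \<le> v" "u + v = 1"
  have "N (u *\<^sub>R x + v *\<^sub>R y) \<le> u * N x + v * N y"
    using seminorm_add[OF assms, of "u *\<^sub>R x" "v *\<^sub>R y"] uv by (simp add: seminorm_scale[OF assms])
  also have "\<dots> \<le> u * 1 + v * 1" using x uv by (intro add_mono mult_left_mono) (auto simp: unit_ball_def)
  finally show "u *\<^sub>R x + v *\<^sub>R y \<in> unit_ball N" using uv by (simp add: unit_ball_def)
qed

lemma compact_line_in_unit_ball:
  assumes N: "seminorm N" and y: "N y \<noteq> 0"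
  shows "compact {t. x + t *\<^sub>R y \<in> unit_ball N}"
proof -
  have pos: "0 < N y" using y seminorm_nonneg[OF N, of y] by simp
  have lip: "\<bar>N (x + s *\<^sub>R y) - N (x + t *\<^sub>R y)\<bar> \<le> N y * \<bar>s - t\<bar>" for s t
  proof -
    have "N (x + s *\<^sub>R y) - N (x + t *\<^sub>R y) \<le> \<bar>s - t\<bar> * N y" for s t
      using seminorm_add[OF N, of "x + t *\<^sub>R y" "(s - t) *\<^sub>R y"] seminorm_scale[OF N, of "s - t" y]
      by (simp add: algebra_simps)
    from this[of s t] this[of t s] show ?thesis by (simp add: mult.commute abs_minus_commute abs_le_iff)
  qed
  have "(N y)-lipschitz_on UNIV (\<lambda>t. N (x + t *\<^sub>R y))"
    using lip seminorm_nonneg[OF N] by (intro lipschitz_onI) (simp_all add: dist_real_def)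
  then have "continuous_on UNIV (\<lambda>t. N (x + t *\<^sub>R y))" by (rule lipschitz_on_continuous_on)
  then have "closed {t. N (x + t *\<^sub>R y) \<le> 1}" by (intro closed_Collect_le continuous_on_const)
  moreover have "bounded {t. N (x + t *\<^sub>R y) \<le> 1}"
  proof -
    have "\<bar>t\<bar> \<le> (1 + N x) / N y" if "N (x + t *\<^sub>R y) \<le> 1" for t
    proof -
      have "\<bar>t\<bar> * N y \<le> N (x + t *\<^sub>R y) + N x"
        using seminorm_add[OF N, of "x + t *\<^sub>R y" "- x"] by (simp add: seminorm_scale[OF N] seminorm_minus[OF N])
      then show ?thesis using pos that by (simp add: field_simps)
    qed
    then show ?thesis by (auto simp: bounded_iff)
  qed
  ultimately show ?thesis by (simp add: compact_eq_bounded_closed unit_ball_def)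
qed

section \<open>The ball and the dual ball of the layered norm\<close>

context layered_norm
begin

lemma V_polyhedral_N: "V_polyhedral N"
  unfolding V_polyhedral_def
proof
  fix x assume "x \<in> unit_sphere N"
  then have x: "N x = 1" by (simp add: unit_sphere_def)
  obtain r where r: "r < 1" "\<And>f. extreme_functional N f \<Longrightarrow> f x \<noteq> 1 \<Longrightarrow> f x \<le> r"
    by (rule extreme_functional_value_gap[OF x], rule that)
  have "ereal (blinfun_apply f x) \<le> ereal r"
    if "f \<in> ext (unit_ball (dual_norm N)) - norming_functionals N x" for f
  proof -
    have f: "f \<in> ext (unit_ball (dual_norm N))" and not_norming: "f \<notin> norming_functionals N x"
      using that by auto
    have "dual_norm N f \<le> 1" using f by (simp add: ext_def extreme_point_of_def unit_ball_def)
    then have "blinfun_apply f x \<noteq> 1"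
      using dual_norm_eq_one[OF equivalent_norm_N _ x] not_norming
      by (auto simp: norming_functionals_def unit_sphere_def)
    then show ?thesis using r(2)[OF extreme_point_of_dual_ball[OF equivalent_norm_N f]] by simp
  qed
  then have "(SUP f\<in>ext (unit_ball (dual_norm N)) - norming_functionals N x. ereal (blinfun_apply f x))
      \<le> ereal r" by (rule SUP_least)
  also have "\<dots> < 1" using r(1) by simp
  finally show "(SUP f\<in>ext (unit_ball (dual_norm N)) - norming_functionals N x.
      ereal (blinfun_apply f x)) < 1" .
qed

text \<open>A point \<open>p\<close> of the algebraic interior can be moved both ways inside the ball in every direction
  of the kernel of \<open>f\<close>. That kernel contains vectors outside any \<open>X n\<close>, obtained by correcting a
  vector outside \<open>X n\<close> by a multiple of \<open>p\<close>.\<close>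

lemma no_algebraic_true_face_N: "\<not> algebraic_true_face N K"
proof
  assume "algebraic_true_face N K"
  then obtain f p where f: "dual_norm N f = 1"
    and K: "K = unit_ball N \<inter> {x. blinfun_apply f x = 1}"
    and p: "p \<in> algebraic_interior_rel K {x. blinfun_apply f x = 1}"
    by (auto simp: algebraic_true_face_def unit_sphere_def)
  have pK: "N p \<le> 1" "blinfun_apply f p = 1"
    using p K by (auto simp: algebraic_interior_rel_def unit_ball_def)
  have "blinfun_apply f p \<le> N p" using f dual_norm_le_one_iff[OF equivalent_norm_N, of f] by auto
  then have Np: "N p = 1" using pK by simp
  obtain n where n: "p \<in> X n" using X_cover by blast
  obtain w where w: "w \<notin> X n" using X_proper by blast
  define y where "y = w - blinfun_apply f w *\<^sub>R p"
  have "blinfun_apply f (p + y) = 1"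
    by (simp add: y_def pK(2) blinfun.add_right blinfun.diff_right blinfun.scaleR_right)
  then obtain \<delta> where \<delta>: "0 < \<delta>" "\<And>t. \<bar>t\<bar> \<le> \<delta> \<Longrightarrow> p + t *\<^sub>R y \<in> K"
    using p by (force simp: algebraic_interior_rel_def)
  have "N (p + \<delta> *\<^sub>R y) \<le> 1" "N (p - \<delta> *\<^sub>R y) \<le> 1"
    using \<delta>(1) \<delta>(2)[of \<delta>] \<delta>(2)[of "- \<delta>"] K by (auto simp: unit_ball_def)
  then have "\<delta> *\<^sub>R y \<in> X n" by (rule segment_in_ball_stays_in_X[OF n Np])
  then have "y \<in> X n" using subspace_scale[OF X_subspace, of "\<delta> *\<^sub>R y" n "1 / \<delta>"] \<delta>(1) by simp
  then have "w \<in> X n"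
    using subspace_add[OF X_subspace _ subspace_scale[OF X_subspace n], of y "blinfun_apply f w"]
    by (simp add: y_def)
  then show False using w by blast
qed

text \<open>A segment of the ball through a point of the sphere in \<open>X n\<close> lies in \<open>X n\<close>, where \<open>x\<close> is extreme.
  The zero space is excluded because there the point 0 is extreme without having norm 1.\<close>

lemma extreme_point_of_section:
  assumes x: "x extreme_point_of (unit_ball N \<inter> X n)" and nontriv: "X n \<noteq> {0}"
  shows "x extreme_point_of unit_ball N"
proof -
  have xX: "x \<in> X n" "N x \<le> 1" using x by (auto simp: extreme_point_of_def unit_ball_def)
  have "N x = 1"
  proof (rule ccontr)
    assume "N x \<noteq> 1"
    then have less: "0 < 1 - N x" using xX by simp
    obtain y where y: "y \<in> X n" "y \<noteq> 0" using nontriv subspace_0[OF X_subspace, of n] by blast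
    have Ny: "0 < N y" using norm_le_N[of y] y(2) by (smt (verit) zero_less_norm_iff)
    define z where "z = ((1 - N x) / N y) *\<^sub>R y"
    have z: "N z = 1 - N x" "z \<in> X n" "z \<noteq> 0"
      using less Ny y by (simp_all add: z_def seminorm_scale[OF seminorm_N] subspace_scale[OF X_subspace])
    have "x + z \<in> unit_ball N \<inter> X n" "x - z \<in> unit_ball N \<inter> X n"
      using z xX seminorm_add[OF seminorm_N, of x z] seminorm_add[OF seminorm_N, of x "- z"]
      by (simp_all add: unit_ball_def seminorm_minus[OF seminorm_N] subspace_add subspace_diff X_subspace)
    then have "z = 0" by (rule extreme_point_of_no_centred_segment[OF x])
    then show False using z(3) by blast
  qed
  show ?thesis
  proof (rule extreme_point_ofI_no_centred_segment[OF convex_unit_ball[OF seminorm_N]])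
    show "x \<in> unit_ball N" using xX by (simp add: unit_ball_def)
    fix y assume y: "x + y \<in> unit_ball N" "x - y \<in> unit_ball N"
    then have "y \<in> X n"
      using segment_in_ball_stays_in_X[OF xX(1) \<open>N x = 1\<close>] by (simp add: unit_ball_def)
    then have "x + y \<in> unit_ball N \<inter> X n" "x - y \<in> unit_ball N \<inter> X n"
      using y xX(1) by (simp_all add: subspace_add subspace_diff X_subspace)
    then show "y = 0" by (rule extreme_point_of_no_centred_segment[OF x])
  qed
qed

text \<open>Minkowski's theorem in the finite-dimensional sections, whose extreme points are extreme in the
  whole ball. The section is enlarged to contain a non-zero vector \<open>z\<close>.\<close>

lemma unit_ball_N_eq_hull: "unit_ball N = convex hull (ext (unit_ball N))"
proof
  show "convex hull (ext (unit_ball N)) \<subseteq> unit_ball N"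
    by (rule hull_minimal) (auto simp: ext_def extreme_point_of_def convex_unit_ball seminorm_N)
  show "unit_ball N \<subseteq> convex hull (ext (unit_ball N))"
  proof
    fix x assume x: "x \<in> unit_ball N"
    obtain z :: 'a where "z \<notin> X 0" using X_proper[of 0] by blast
    then have z: "z \<noteq> 0" using subspace_0[OF X_subspace, of 0] by auto
    obtain m k where "x \<in> X m" "z \<in> X k" using X_cover by metis
    then have xz: "x \<in> X (max m k)" "z \<in> X (max m k)"
      using X_mono[of m "max m k"] X_mono[of k "max m k"] by auto
    let ?C = "unit_ball N \<inter> X (max m k)"
    obtain A where A: "finite A" "X (max m k) = span A" using X_finite_dim by blast
    have "?C \<subseteq> convex hull {x. x extreme_point_of ?C}"
    proof (rule Minkowski_finite_dimensional[OF _ A(1)])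
      show "convex ?C"
        by (intro convex_Int convex_unit_ball seminorm_N subspace_imp_convex X_subspace)
      show "?C \<subseteq> span A" using A(2) by blast
      fix u v :: 'a assume u: "u \<in> ?C" and v: "v \<noteq> 0"
      have N_pos: "N w \<noteq> 0" if "w \<noteq> 0" for w using norm_le_N[of w] that by auto
      show "compact {t. u + t *\<^sub>R v \<in> ?C}"
      proof (cases "v \<in> X (max m k)")
        case True
        then have "{t. u + t *\<^sub>R v \<in> ?C} = {t. u + t *\<^sub>R v \<in> unit_ball N}"
          using u by (auto intro: subspace_add subspace_scale X_subspace)
        then show ?thesis using compact_line_in_unit_ball[OF seminorm_N N_pos[OF v]] by simp
      next
        case False
        have "t = 0" if "u + t *\<^sub>R v \<in> X (max m k)" for t
        proof (rule ccontr)
          assume "t \<noteq> 0"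
          then have "v = (1 / t) *\<^sub>R ((u + t *\<^sub>R v) - u)" by simp
          also have "\<dots> \<in> X (max m k)"
            using u that by (intro subspace_scale subspace_diff X_subspace) auto
          finally show False using False by blast
        qed
        then have "{t. u + t *\<^sub>R v \<in> ?C} \<subseteq> {0}" by auto
        then show ?thesis by (meson finite.emptyI finite_imp_compact finite_insert finite_subset)
      qed
    qed
    moreover have "{x. x extreme_point_of ?C} \<subseteq> ext (unit_ball N)"
      using extreme_point_of_section xz(2) z by (force simp: ext_def)
    ultimately show "x \<in> convex hull (ext (unit_ball N))"
      using x xz(1) hull_mono[of "{x. x extreme_point_of ?C}" "ext (unit_ball N)" convex] by blast
  qed
qed

end

section \<open>Existence of the filtration and the functionals\<close>

lemma layered_norm_exists:
  fixes E :: "'a::real_normed_vector set"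
  assumes "independent E" and "span E = UNIV" and "countable E" and "infinite E"
  obtains X :: "nat \<Rightarrow> 'a set" and \<xi> F where "layered_norm X \<xi> F"
proof -
  obtain e :: "nat \<Rightarrow> 'a" where e: "bij_betw e UNIV E"
    using bij_betw_from_nat_into[OF assms(3,4)] by blast
  have inj: "inj e" and E: "E = range e" using e by (auto simp: bij_betw_def)
  define A where "A n = e ` {..<n}" for n
  define X where "X n = span (A n)" for n
  have A_Suc: "A (Suc n) = insert (e n) (A n)" for n by (simp add: A_def lessThan_Suc)
  have finA: "finite (A n)" for n by (simp add: A_def)
  have e_notin: "e n \<notin> span (A n)" for n
  proof
    assume "e n \<in> span (A n)"
    moreover have "A n \<subseteq> E - {e n}" using inj by (auto simp: A_def E inj_eq)
    ultimately have "e n \<in> span (E - {e n})" using span_mono by blast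
    then show False using assms(1) E by (auto simp: dependent_def)
  qed
  have mono: "X m \<subseteq> X n" if "m \<le> n" for m n
    unfolding X_def A_def using that by (intro span_mono image_mono) auto
  have cover: "\<exists>n. x \<in> X n" for x
  proof -
    have "x \<in> span (range e)" using assms(2) E by simp
    then obtain t r where t: "finite t" "t \<subseteq> range e" "x = (\<Sum>a\<in>t. r a *\<^sub>R a)"
      unfolding span_explicit by blast
    obtain M where M: "finite M" "t = e ` M" using finite_subset_image[OF t(1,2)] by blast
    obtain n where "M \<subseteq> {..<n}" using M(1) finite_nat_bounded by blast
    then have "t \<subseteq> A n" using M(2) by (auto simp: A_def)
    then have "x \<in> X n" unfolding X_def t(3) by (intro span_sum span_scale span_base) auto
    then show ?thesis ..
  qed
  have "\<exists>\<xi> :: 'a \<Rightarrow> real. linear \<xi> \<and> (\<forall>x. \<bar>\<xi> x\<bar> \<le> norm x) \<and> (\<forall>x\<in>span (A n). \<xi> x = 0) \<and> \<xi> (e n) \<noteq> 0" for n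
    by (rule bounded_functional_separating_span[OF finA e_notin]) blast
  then obtain \<xi> :: "nat \<Rightarrow> 'a \<Rightarrow> real" where \<xi>: "\<And>n. linear (\<xi> n)" "\<And>n x. \<bar>\<xi> n x\<bar> \<le> norm x"
      "\<And>n x. x \<in> X n \<Longrightarrow> \<xi> n x = 0" "\<And>n. \<xi> n (e n) \<noteq> 0"
    unfolding X_def by metis
  have "\<exists>F :: ('a \<Rightarrow> real) set. finite F \<and> F \<noteq> {} \<and> (\<forall>\<phi>\<in>F. linear \<phi> \<and> (\<forall>x. \<bar>\<phi> x\<bar> \<le> norm x)) \<and>
      (\<forall>x\<in>span (A n). \<exists>\<phi>\<in>F. norming_factor n / layer_weight n * norm x \<le> \<bar>\<phi> x\<bar>)" for n
  proof -
    have c: "norming_factor n / layer_weight n < 1"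
      unfolding norming_factor_def layer_weight_def by (simp add: add_pos_pos)
    show ?thesis by (rule finitely_many_almost_norming_functionals[OF finA c]) blast
  qed
  then obtain F :: "nat \<Rightarrow> ('a \<Rightarrow> real) set" where F: "\<And>n. finite (F n)" "\<And>n. F n \<noteq> {}"
      "\<And>n \<phi>. \<phi> \<in> F n \<Longrightarrow> linear \<phi> \<and> (\<forall>x. \<bar>\<phi> x\<bar> \<le> norm x)"
      "\<And>n x. x \<in> X n \<Longrightarrow> \<exists>\<phi>\<in>F n. norming_factor n / layer_weight n * norm x \<le> \<bar>\<phi> x\<bar>"
    unfolding X_def by metis
  have "layered_norm X \<xi> F"
  proof (rule layered_norm.intro)
    show "X n \<noteq> UNIV" for n using e_notin[of n] by (auto simp: X_def)
    show "\<exists>A. finite A \<and> X n = span A" for n using finA X_def by blast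
    show "\<xi> n x \<noteq> 0" if x: "x \<in> X (Suc n)" "x \<notin> X n" for n x
    proof -
      obtain t where t: "x - t *\<^sub>R e n \<in> X n"
        using x(1) by (auto simp: X_def A_Suc span_breakdown_eq)
      then have "\<xi> n x = t * \<xi> n (e n)"
        using \<xi>(3)[OF t] by (simp add: linear_diff[OF \<xi>(1)] linear_scale[OF \<xi>(1)])
      moreover have "t \<noteq> 0" using t x(2) by auto
      ultimately show ?thesis using \<xi>(4) by simp
    qed
    show "\<exists>\<phi>\<in>F n. norming_factor n * norm x \<le> layer_weight n * \<bar>\<phi> x\<bar>" if "x \<in> X n" for n x
    proof -
      have "0 < layer_weight n" by (simp add: layer_weight_def add_pos_pos)
      then show ?thesis using F(4)[OF that] by (auto simp: field_simps)
    qed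
  qed (use mono cover \<xi> F in \<open>simp_all add: X_def\<close>)
  then show ?thesis by (rule that)
qed

theorem theorem5p9:
  fixes E :: "'a::real_normed_vector set"
  assumes "independent E" and "span E = UNIV" and "countable E" and "infinite E"
  shows "\<exists>N :: 'a \<Rightarrow> real. equivalent_norm N \<and> V_polyhedral N \<and>
           (\<nexists>F. algebraic_true_face N F) \<and>
           unit_ball N = convex hull (ext (unit_ball N))"
proof -
  obtain X :: "nat \<Rightarrow> 'a set" and \<xi> F where "layered_norm X \<xi> F"
    by (rule layered_norm_exists[OF assms])
  then interpret layered_norm X \<xi> F .
  show ?thesis
    using equivalent_norm_N V_polyhedral_N no_algebraic_true_face_N unit_ball_N_eq_hull by blast
qed

end
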